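(* Let $p>1$, $p'=\frac{p}{p-1}$, and let $v$ be a weight on $(0,\infty)$ belonging to both classes $M_p^*$ and $m_p^*$. A measurable function $h:(0,\infty)\to\mathbb{R}$ belongs to $\mathrm{Cop}_p(v)$ if and only if it admits a factorization $h=f\cdot g$ with $f\in L^p(v)$ and $g\in G^*_{p'}(v^{1-p'})$. Moreover, for every such $h$, $$[v]_{m_p^*}\,N^*(h)\le\|h\|_{\mathrm{Cop}_p(v)}\le (p')^{1/p'}p^{1/p}\,[v]_{M_p^*}\,N^*(h),$$ where $$N^*(h)=\inf\|f\|_{L^p(v)}\|g\|_{G^*_{p'}(v^{1-p'})},$$ the infimum being taken over all factorizations $h=f\cdot g$ with $f\in L^p(v)$ and $g\in G^*_{p'}(v^{1-p'})$.
   Context: All functions are real-valued and Lebesgue measurable on $(0,\infty)$; equalities between functions are a.e. A weight is a function $v$ that is positive a.e. and locally integrable on $(0,\infty)$. $\|f\|_{L^p(v)}=\left(\int_0^\infty |f(x)|^p v(x)\,dx\right)^{1/p}$. The weighted Copson space $\mathrm{Cop}_p(v)$ is the set of functions $f$ with $$\|f\|_{\mathrm{Cop}_p(v)}=\left(\int_0^\infty\left(\int_t^\infty\frac{|f(x)|}{x}\,dx\right)^p v(t)\,dt\right)^{1/p}<\infty.$$ For $q>0$ and a weight $u$, $G^*_q(u)$ is the set of functions $g$ with $$\|g\|_{G^*_q(u)}=\sup_{t>0}\left(\frac{1}{\int_t^\infty u(x)x^{-q}\,dx}\int_t^\infty|g(x)|^q u(x)x^{-q}\,dx\right)^{1/q}<\infty.$$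 The class $M_p^*$ consists of the weights $v$ for which there is a constant $C>0$ such that, for all $t>0$, $$\left(\int_0^t v(x)\,dx\right)^{1/p}\left(\int_t^\infty\frac{v^{1-p'}(x)}{x^{p'}}\,dx\right)^{1/p'}\le C,$$ and $[v]_{M_p^*}$ is the least such $C$. The class $m_p^*$ consists of the weights for which the reverse inequality ($\ge C$ for all $t>0$) holds with some constant $C>0$, and $[v]_{m_p^*}$ is the largest such $C$. *)

theory Defs
  imports "HOL-Analysis.Analysis"
begin

text \<open>All functions live on the half-line (0, infinity): they are modelled as total functions on
  the reals whose values outside \<open>{0<..}\<close> are never inspected. Norms take values in
  \<^typ>\<open>ennreal\<close>, so that they make sense for every measurable function.\<close>

text \<open>Real powers of extended nonnegative reals. It is only meant for exponents \<open>a > 0\<close>, where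
  \<open>0 powr a = 0\<close> and infinity to the power \<open>a\<close> is infinity.\<close>

definition ennpowr :: "ennreal \<Rightarrow> real \<Rightarrow> ennreal" (infixr "ennpowr" 80)
  where "x ennpowr a = (if x = top then top else ennreal (enn2real x powr a))"

definition conj_exp :: "real \<Rightarrow> real"
  where "conj_exp p = p / (p - 1)"

definition half_measurable :: "(real \<Rightarrow> real) \<Rightarrow> bool"
  where "half_measurable f \<longleftrightarrow> f \<in> borel_measurable (lebesgue_on {0<..})"

text \<open>Local integrability is integrability on the compact subsets of the open half-line; nothing is
  required at the endpoint 0.\<close>

definition weight :: "(real \<Rightarrow> real) \<Rightarrow> bool"
  where "weight v \<longleftrightarrow> half_measurable v \<and> (AE x in lebesgue_on {0<..}. v x > 0) \<and>
    (\<forall>K. compact K \<and> K \<subseteq> {0<..} \<longrightarrow> set_integrable lebesgue K v)"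

definition Lp_norm :: "real \<Rightarrow> (real \<Rightarrow> real) \<Rightarrow> (real \<Rightarrow> real) \<Rightarrow> ennreal"
  where "Lp_norm p v f =
    (\<integral>\<^sup>+ x \<in> {0<..}. ennreal (\<bar>f x\<bar> powr p * v x) \<partial>lebesgue) ennpowr (1 / p)"

definition Lp :: "real \<Rightarrow> (real \<Rightarrow> real) \<Rightarrow> (real \<Rightarrow> real) set"
  where "Lp p v = {f. half_measurable f \<and> Lp_norm p v f < \<infinity>}"

definition Cop_norm :: "real \<Rightarrow> (real \<Rightarrow> real) \<Rightarrow> (real \<Rightarrow> real) \<Rightarrow> ennreal"
  where "Cop_norm p v f =
    (\<integral>\<^sup>+ t \<in> {0<..}. (\<integral>\<^sup>+ x \<in> {t<..}. ennreal (\<bar>f x\<bar> / x) \<partial>lebesgue) ennpowr p * ennreal (v t)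
       \<partial>lebesgue) ennpowr (1 / p)"

definition Cop :: "real \<Rightarrow> (real \<Rightarrow> real) \<Rightarrow> (real \<Rightarrow> real) set"
  where "Cop p v = {f. half_measurable f \<and> Cop_norm p v f < \<infinity>}"

definition Gstar_norm :: "real \<Rightarrow> (real \<Rightarrow> real) \<Rightarrow> (real \<Rightarrow> real) \<Rightarrow> ennreal"
  where "Gstar_norm q u g =
    (SUP t \<in> {0<..}.
      (1 / (\<integral>\<^sup>+ x \<in> {t<..}. ennreal (u x * x powr (- q)) \<partial>lebesgue) *
       (\<integral>\<^sup>+ x \<in> {t<..}. ennreal (\<bar>g x\<bar> powr q * u x * x powr (- q)) \<partial>lebesgue)) ennpowr (1 / q))"

definition Gstar :: "real \<Rightarrow> (real \<Rightarrow> real) \<Rightarrow> (real \<Rightarrow> real) set"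
  where "Gstar q u = {g. half_measurable g \<and> Gstar_norm q u g < \<infinity>}"

definition dual_weight :: "real \<Rightarrow> (real \<Rightarrow> real) \<Rightarrow> (real \<Rightarrow> real)"
  where "dual_weight p v = (\<lambda>x. v x powr (1 - conj_exp p))"

definition Mstar_product :: "real \<Rightarrow> (real \<Rightarrow> real) \<Rightarrow> real \<Rightarrow> ennreal"
  where "Mstar_product p v t =
    (\<integral>\<^sup>+ x \<in> {0<..<t}. ennreal (v x) \<partial>lebesgue) ennpowr (1 / p) *
    (\<integral>\<^sup>+ x \<in> {t<..}. ennreal (v x powr (1 - conj_exp p) / x powr conj_exp p) \<partial>lebesgue)
       ennpowr (1 / conj_exp p)"

definition Mstar :: "real \<Rightarrow> (real \<Rightarrow> real) set"
  where "Mstar p = {v. weight v \<and> (\<exists>C>0. \<forall>t>0. Mstar_product p v t \<le> ennreal C)}"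

definition Mstar_const :: "real \<Rightarrow> (real \<Rightarrow> real) \<Rightarrow> real"
  where "Mstar_const p v = (LEAST C. C > 0 \<and> (\<forall>t>0. Mstar_product p v t \<le> ennreal C))"

definition mstar :: "real \<Rightarrow> (real \<Rightarrow> real) set"
  where "mstar p = {v. weight v \<and> (\<exists>C>0. \<forall>t>0. Mstar_product p v t \<ge> ennreal C)}"

text \<open>The greatest constant exists as soon as the product is finite for some \<open>t\<close>, in particular
  for weights that also lie in \<^const>\<open>Mstar\<close>.\<close>

definition mstar_const :: "real \<Rightarrow> (real \<Rightarrow> real) \<Rightarrow> real"
  where "mstar_const p v = (GREATEST C. C > 0 \<and> (\<forall>t>0. Mstar_product p v t \<ge> ennreal C))"

definition factorizations ::
    "real \<Rightarrow> (real \<Rightarrow> real) \<Rightarrow> (real \<Rightarrow> real) \<Rightarrow> ((real \<Rightarrow> real) \<times> (real \<Rightarrow> real)) set"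
  where "factorizations p v h =
    {(f, g). f \<in> Lp p v \<and> g \<in> Gstar (conj_exp p) (dual_weight p v) \<and>
             (AE x in lebesgue_on {0<..}. h x = f x * g x)}"

text \<open>The infimum over the empty set would be infinity.\<close>

definition Nstar :: "real \<Rightarrow> (real \<Rightarrow> real) \<Rightarrow> (real \<Rightarrow> real) \<Rightarrow> ennreal"
  where "Nstar p v h =
    (INF (f, g) \<in> factorizations p v h.
       Lp_norm p v f * Gstar_norm (conj_exp p) (dual_weight p v) g)"

end

theory Submission
  imports Defs
begin

text \<open>
  Write \<open>q = p / (p - 1)\<close>, \<open>V t\<close> for the integral of \<open>v\<close> over \<open>(0, t)\<close>, \<open>W t\<close> for the integral of
  \<open>w x = v x powr (1 - q) / x powr q\<close> over \<open>(t, \<infinity>)\<close>, and \<open>H t\<close> for the integral of \<open>\<bar>h x\<bar> / x\<close>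
  over \<open>(t, \<infinity>)\<close>. The two weight classes say that \<open>V t powr (1 / p) * W t powr (1 / q)\<close> lies
  between positive constants \<open>c\<close> and \<open>C\<close>; the norm of \<open>g\<close> in the space \<open>G*\<close> is the least \<open>G\<close> for
  which the integral of \<open>\<bar>g\<bar> powr q * w\<close> over every tail \<open>(t, \<infinity>)\<close> is at most
  \<open>G powr q * W t\<close>.

  The upper estimate is Hardy's inequality with a Muckenhoupt weight, applied to a product. If
  \<open>h = f * g\<close>, Hoelder's inequality with the auxiliary factor \<open>W powr (1 / (p * q))\<close> bounds
  \<open>H t powr p\<close> by the tail integral of \<open>\<bar>f\<bar> powr p * v * W powr (1 / q)\<close> times a power of the tail
  integral of \<open>\<bar>g\<bar> powr q * w * W powr (- 1 / p)\<close>. For \<open>g = 1\<close> the latter would be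
  \<open>q * W t powr (1 / q)\<close>. For general \<open>g\<close> it is at most \<open>G powr q\<close> times this value, since the bound
  on all tails of \<open>\<bar>g\<bar> powr q * w\<close> controls the mass where \<open>W\<close> is small, which is all that a negative
  power of \<open>W\<close> sees (\<open>tail_power_rule\<close>). Next \<open>W\<close> is traded for \<open>V\<close> through the constant \<open>C\<close>, the
  order of integration is exchanged, and the mirrored rule \<open>head_power_rule\<close> integrates
  \<open>v * V powr (1 / p - 1)\<close>. The factors produced on the way multiply up to the \<open>p\<close>-th power of
  \<open>q powr (1 / q) * p powr (1 / p) * C * G\<close> (\<open>Cop_norm_le_of_factorization\<close>).

  The lower estimate comes from an explicit factorization (\<open>factorization_of_Cop\<close>). Let \<open>S x\<close> be the
  integral of \<open>v * H powr (p - 1)\<close> over \<open>(0, x)\<close> and define \<open>f \<ge> 0\<close> by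
  \<open>f x powr p * v x = \<bar>h x\<bar> / x * S x\<close>. Exchanging the order of integration turns the integral of
  the right-hand side into that of \<open>v * H powr (p - 1) * H\<close>, so that \<open>f\<close> has exactly the Copson
  norm of \<open>h\<close>. For \<open>g = h / f\<close> one computes \<open>\<bar>g\<bar> powr q * w = \<bar>h x\<bar> / x * S x powr (1 - q)\<close>.
  Here \<open>S\<close> increases, and \<open>S t \<ge> V t * H t powr (p - 1)\<close> because \<open>H\<close> decreases; hence the
  tail integral of \<open>\<bar>g\<bar> powr q * w\<close> is at most
  \<open>H t * S t powr (1 - q) \<le> V t powr (1 - q) \<le> (1 / c) powr q * W t\<close>, that is, the norm of
  \<open>g\<close> is at most \<open>1 / c\<close>.
\<close>

section \<open>Powers of extended nonnegative reals\<close>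

lemma ennpowr_ennreal: "0 \<le> x \<Longrightarrow> ennreal x ennpowr a = ennreal (x powr a)"
  by (simp add: ennpowr_def)

lemma ennpowr_top [simp]: "top ennpowr a = top"
  by (simp add: ennpowr_def)

lemma ennpowr_zero [simp]: "0 ennpowr a = 0"
  by (simp add: ennpowr_def)

lemma ennpowr_one [simp]: "x ennpowr 1 = x"
  by (cases x) (simp_all add: ennpowr_ennreal)

lemma ennpowr_mono: "x \<le> y \<Longrightarrow> 0 \<le> a \<Longrightarrow> x ennpowr a \<le> y ennpowr a"
  by (cases x; cases y) (auto simp: ennpowr_ennreal top_unique intro!: ennreal_leI powr_mono2)

lemma ennpowr_mult:
  assumes "0 < a" shows "(x * y) ennpowr a = x ennpowr a * y ennpowr a"
  by (cases x; cases y)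
     (auto simp: ennpowr_ennreal ennreal_mult[symmetric] powr_mult ennreal_mult_top
        ennreal_top_mult ennreal_mult_eq_top_iff)

lemma ennpowr_ennpowr: "(x ennpowr a) ennpowr b = x ennpowr (a * b)"
  by (cases x) (simp_all add: ennpowr_ennreal powr_powr)

lemma ennpowr_eq_0_iff [simp]: "x ennpowr a = 0 \<longleftrightarrow> x = 0"
  by (cases x) (auto simp: ennpowr_ennreal ennreal_eq_0_iff)

lemma ennpowr_eq_top_iff [simp]: "x ennpowr a = top \<longleftrightarrow> x = top"
  by (cases x) (auto simp: ennpowr_ennreal)

lemma ennpowr_less_top_iff [simp]: "x ennpowr a < top \<longleftrightarrow> x < top"
  by (metis ennpowr_eq_top_iff less_top)

lemma ennpowr_add: "x \<noteq> top \<Longrightarrow> x ennpowr (a + b) = x ennpowr a * x ennpowr b"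
  by (cases x) (simp_all add: ennpowr_ennreal powr_add ennreal_mult)

lemma measurable_ennpowr [measurable (raw)]:
  "f \<in> borel_measurable M \<Longrightarrow> (\<lambda>x. f x ennpowr a) \<in> borel_measurable M"
  unfolding ennpowr_def by (intro measurable_If) (measurable, auto)

lemma conjugate_exponents:
  fixes p q :: real
  assumes "p > 1" "q = p / (p - 1)"
  shows "q > 1" "1 / p + 1 / q = 1" "1 / q = 1 - 1 / p" "q / p = q - 1" "q * (p - 1) = p"
proof -
  show q: "q > 1" "1 / p + 1 / q = 1"
    using assms(1) unfolding assms(2) by (simp_all add: field_simps)
  show "1 / q = 1 - 1 / p" "q / p = q - 1" "q * (p - 1) = p"
    using assms(1) unfolding assms(2) by (simp_all add: field_simps)
qed

section \<open>Hoelder's inequality\<close>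

text \<open>The majorant \<open>B\<close> replaces the integral of \<open>b powr q\<close> because only upper bounds for that integral
  are available below, and raising to the power \<open>p\<close> matches the integrand of the Copson norm. The
  proof integrates Young's inequality for the two normalized factors; the normalization is why the
  cases where one of the integrals vanishes or is infinite are separate.\<close>

lemma nn_integral_Holder:
  fixes a b :: "'a \<Rightarrow> real"
  assumes [measurable]: "a \<in> borel_measurable M" "b \<in> borel_measurable M"
    and nonneg: "\<And>x. 0 \<le> a x" "\<And>x. 0 \<le> b x"
    and pq: "p > 1" "q = p / (p - 1)"
    and B: "0 \<le> B" "(\<integral>\<^sup>+x. ennreal (b x powr q) \<partial>M) \<le> ennreal B"
  shows "(\<integral>\<^sup>+x. ennreal (a x * b x) \<partial>M) ennpowr p
           \<le> (\<integral>\<^sup>+x. ennreal (a x powr p) \<partial>M) * ennreal (B powr (p - 1))"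
proof -
  note e = conjugate_exponents[OF pq]
  let ?A = "\<integral>\<^sup>+x. ennreal (a x powr p) \<partial>M"
  consider "B = 0" | "0 < B" "?A = top" | "?A = 0" | A where "0 < B" "0 < A" "?A = ennreal A"
    using B by (cases ?A) (auto simp: less_le)
  then show ?thesis
  proof cases
    case 1
    with B have "AE x in M. ennreal (b x powr q) = 0"
      by (subst nn_integral_0_iff_AE[symmetric]) auto
    then have "AE x in M. ennreal (a x * b x) = 0"
      by eventually_elim (simp add: nonneg ennreal_eq_0_iff powr_def split: if_splits)
    then have "(\<integral>\<^sup>+x. ennreal (a x * b x) \<partial>M) = 0"
      by (subst nn_integral_0_iff_AE) auto
    then show ?thesis by simp
  next
    case 2
    then show ?thesis by (simp add: ennreal_top_mult)
  next
    case 3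
    then have "AE x in M. ennreal (a x powr p) = 0"
      by (subst (asm) nn_integral_0_iff_AE) auto
    then have "AE x in M. ennreal (a x * b x) = 0"
      by eventually_elim (simp add: nonneg ennreal_eq_0_iff powr_def split: if_splits)
    then have "(\<integral>\<^sup>+x. ennreal (a x * b x) \<partial>M) = 0"
      by (subst nn_integral_0_iff_AE) auto
    then show ?thesis by simp
  next
    case (4 A)
    note B = \<open>0 < B\<close> B(2)
    define K where "K = A powr (1/p) * B powr (1/q)"
    have K: "0 < K" using 4 B by (simp add: K_def)
    have "(\<integral>\<^sup>+x. ennreal (a x * b x) \<partial>M)
        \<le> (\<integral>\<^sup>+x. ennreal (K / (p * A)) * ennreal (a x powr p) +
                 ennreal (K / (q * B)) * ennreal (b x powr q) \<partial>M)"
    proof (rule nn_integral_mono)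
      fix x
      have "a x / A powr (1/p) * (b x / B powr (1/q))
          \<le> (a x / A powr (1/p)) powr p / p + (b x / B powr (1/q)) powr q / q"
        using pq e nonneg by (intro Youngs_inequality) auto
      also have "\<dots> = a x powr p / (p * A) + b x powr q / (q * B)"
        using pq e nonneg 4 B by (simp add: powr_divide powr_powr field_simps)
      finally have "K * (a x / A powr (1/p) * (b x / B powr (1/q)))
          \<le> K * (a x powr p / (p * A) + b x powr q / (q * B))"
        using K by (intro mult_left_mono) auto
      moreover have "K * (a x / A powr (1/p) * (b x / B powr (1/q))) = a x * b x"
        using 4 B by (simp add: K_def)
      ultimately have "a x * b x \<le> K / (p * A) * a x powr p + K / (q * B) * b x powr q"
        by (simp add: algebra_simps)
      then show "ennreal (a x * b x) \<le> ennreal (K / (p * A)) * ennreal (a x powr p) +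
                 ennreal (K / (q * B)) * ennreal (b x powr q)"
        using K pq e 4 B by (simp add: ennreal_mult[symmetric] ennreal_plus[symmetric] ennreal_leI
            del: ennreal_plus)
    qed
    also have "\<dots> = ennreal (K / (p * A)) * ?A +
        ennreal (K / (q * B)) * (\<integral>\<^sup>+x. ennreal (b x powr q) \<partial>M)"
      by (simp add: nn_integral_add nn_integral_cmult)
    also have "\<dots> \<le> ennreal (K / (p * A)) * ennreal A + ennreal (K / (q * B)) * ennreal B"
      using 4 B by (intro add_mono mult_left_mono) auto
    also have "\<dots> = ennreal (K / (p * A) * A + K / (q * B) * B)"
      using K pq e 4 B by (simp add: ennreal_mult[symmetric] ennreal_plus[symmetric]
            del: ennreal_plus)
    also have "K / (p * A) * A + K / (q * B) * B = K * (1 / p + 1 / q)"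
      using 4 B by (simp add: field_simps)
    also have "\<dots> = K" using e by simp
    finally have "(\<integral>\<^sup>+x. ennreal (a x * b x) \<partial>M) ennpowr p \<le> ennreal K ennpowr p"
      using pq by (intro ennpowr_mono) auto
    also have "\<dots> = ennreal A * ennreal (B powr (p - 1))"
      using K 4 B pq e by (simp add: ennpowr_ennreal K_def powr_mult powr_powr ennreal_mult[symmetric])
    finally show ?thesis using 4 by simp
  qed
qed

section \<open>Integration over the half-line\<close>

abbreviation half_lebesgue :: "real measure"
  where "half_lebesgue \<equiv> lebesgue_on {0<..}"

lemma measurable_ident_half_lebesgue [measurable]: "(\<lambda>x. x) \<in> borel_measurable half_lebesgue"
  by (rule measurable_restrict_space1) (simp add: measurable_completion)

lemma sigma_finite_half_lebesgue: "sigma_finite_measure half_lebesgue"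
proof -
  obtain C :: "real set set" where "countable C" "C \<subseteq> sets lborel" "\<Union>C = space lborel"
      "\<forall>a\<in>C. emeasure lborel a \<noteq> \<infinity>"
    using lborel.sigma_finite_countable by blast
  then have "sigma_finite_measure (lebesgue :: real measure)"
    by (intro sigma_finite_measure.intro exI[of _ C]) auto
  then show ?thesis
    by (rule sigma_finite_measure_restrict_space) auto
qed

lemma nn_integral_Ioi_half_lebesgue:
  assumes "0 \<le> t"
  shows "(\<integral>\<^sup>+x\<in>{t<..}. f x \<partial>lebesgue) = (\<integral>\<^sup>+x\<in>{t<..}. f x \<partial>half_lebesgue)"
  using assms
  by (subst nn_integral_restrict_space) (auto intro!: nn_integral_cong split: split_indicator)

lemma nn_integral_half_line:
  "(\<integral>\<^sup>+x\<in>{0<..}. f x \<partial>lebesgue) = (\<integral>\<^sup>+x. f x \<partial>half_lebesgue)"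
  by (subst nn_integral_restrict_space) auto

lemma nn_integral_Ioo_half_lebesgue:
  "(\<integral>\<^sup>+x\<in>{0<..<t}. f x \<partial>lebesgue) = (\<integral>\<^sup>+x\<in>{..<t}. f x \<partial>half_lebesgue)"
  by (subst nn_integral_restrict_space) (auto intro!: nn_integral_cong split: split_indicator)

text \<open>Both sides integrate \<open>a t * b x\<close> over the triangle \<open>t < x\<close>.\<close>

lemma nn_integral_triangle:
  fixes a b :: "real \<Rightarrow> ennreal"
  assumes "sigma_finite_measure M" and [measurable]: "(\<lambda>x. x) \<in> borel_measurable M"
    and [measurable]: "a \<in> borel_measurable M" "b \<in> borel_measurable M"
  shows "(\<integral>\<^sup>+t. a t * (\<integral>\<^sup>+x\<in>{t<..}. b x \<partial>M) \<partial>M) = (\<integral>\<^sup>+x. b x * (\<integral>\<^sup>+t\<in>{..<x}. a t \<partial>M) \<partial>M)"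
proof -
  interpret sigma_finite_measure M by fact
  interpret pair_sigma_finite M M ..
  have "(\<integral>\<^sup>+t. a t * (\<integral>\<^sup>+x\<in>{t<..}. b x \<partial>M) \<partial>M)
      = (\<integral>\<^sup>+t. (\<integral>\<^sup>+x. a t * b x * (if t < x then 1 else 0) \<partial>M) \<partial>M)"
    by (simp add: nn_integral_cmult[symmetric] indicator_def of_bool_def mult.assoc)
  also have "\<dots> = (\<integral>\<^sup>+x. (\<integral>\<^sup>+t. a t * b x * (if t < x then 1 else 0) \<partial>M) \<partial>M)"
    by (rule Fubini') measurable
  also have "\<dots> = (\<integral>\<^sup>+x. b x * (\<integral>\<^sup>+t\<in>{..<x}. a t \<partial>M) \<partial>M)"
    by (simp add: nn_integral_cmult[symmetric] indicator_def of_bool_def mult_ac)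
  finally show ?thesis .
qed


lemma measurable_head [measurable]:
  fixes u :: "real \<Rightarrow> ennreal"
  assumes [measurable]: "u \<in> borel_measurable half_lebesgue"
  shows "(\<lambda>t. \<integral>\<^sup>+x\<in>{..<t}. u x \<partial>half_lebesgue) \<in> borel_measurable half_lebesgue"
proof -
  interpret sigma_finite_measure half_lebesgue by (rule sigma_finite_half_lebesgue)
  have "(\<lambda>t. \<integral>\<^sup>+x. u x * (if x < t then 1 else 0) \<partial>half_lebesgue) \<in> borel_measurable half_lebesgue"
    by measurable
  then show ?thesis by (simp add: indicator_def of_bool_def)
qed

lemma measurable_tail [measurable]:
  fixes u :: "real \<Rightarrow> ennreal"
  assumes [measurable]: "u \<in> borel_measurable half_lebesgue"
  shows "(\<lambda>t. \<integral>\<^sup>+x\<in>{t<..}. u x \<partial>half_lebesgue) \<in> borel_measurable half_lebesgue"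
proof -
  interpret sigma_finite_measure half_lebesgue by (rule sigma_finite_half_lebesgue)
  have "(\<lambda>t. \<integral>\<^sup>+x. u x * (if t < x then 1 else 0) \<partial>half_lebesgue) \<in> borel_measurable half_lebesgue"
    by measurable
  then show ?thesis by (simp add: indicator_def of_bool_def)
qed

lemma emeasure_half_lebesgue_Ioo:
  assumes "0 \<le> a" "a < b" shows "emeasure half_lebesgue {a<..<b} \<noteq> 0"
  using assms by (subst emeasure_restrict_space) auto

lemma nn_integral_pos_of_AE_pos:
  fixes u :: "real \<Rightarrow> real"
  assumes [measurable]: "u \<in> borel_measurable half_lebesgue" and "AE x in half_lebesgue. 0 < u x"
    and ab: "0 \<le> a" "a < b" "{a<..<b} \<subseteq> A" and [measurable]: "A \<in> sets borel"
  shows "(\<integral>\<^sup>+x\<in>A. ennreal (u x) \<partial>half_lebesgue) \<noteq> 0"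
proof
  have [measurable]: "(indicator A :: real \<Rightarrow> ennreal) \<in> borel_measurable half_lebesgue"
    by (rule measurable_restrict_space1) (simp add: measurable_completion)
  assume "(\<integral>\<^sup>+x\<in>A. ennreal (u x) \<partial>half_lebesgue) = 0"
  then have "AE x in half_lebesgue. ennreal (u x) * indicator A x = 0"
    by (subst (asm) nn_integral_0_iff_AE) auto
  with assms(2) have "AE x in half_lebesgue. x \<notin> {a<..<b}"
    by eventually_elim (use ab in \<open>auto split: split_indicator_asm simp: ennreal_eq_0_iff\<close>)
  then have "emeasure half_lebesgue {x \<in> space half_lebesgue. \<not> x \<notin> {a<..<b}} = 0"
    by (rule AE_E2) measurable
  moreover have "{x \<in> space half_lebesgue. \<not> x \<notin> {a<..<b}} = {a<..<b}"
    using ab by auto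
  ultimately show False
    using emeasure_half_lebesgue_Ioo[of a b] ab by simp
qed

text \<open>Used to pass from the open tails (or heads) on which mass is controlled to a sublevel set of a
  monotone function, which may contain its endpoint: the endpoint goes into \<open>Z\<close>.\<close>

lemma emeasure_le_of_increasing_cover:
  fixes I :: "nat \<Rightarrow> 'a set"
  assumes "incseq I" "\<And>n. I n \<in> sets M" "Z \<in> null_sets M" "S \<subseteq> Z \<union> (\<Union>n. I n)"
    and "\<And>n. emeasure M (I n) \<le> B"
  shows "emeasure M S \<le> B"
proof -
  have "emeasure M S \<le> emeasure M ((\<Union>n. I n) \<union> Z)"
    using assms by (intro emeasure_mono) auto
  also have "\<dots> = emeasure M (\<Union>n. I n)"
    using assms by (intro emeasure_Un_null_set) auto
  also have "\<dots> = (SUP n. emeasure M (I n))"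
    using assms by (intro SUP_emeasure_incseq[symmetric]) auto
  also have "\<dots> \<le> B"
    using assms by (intro SUP_least) auto
  finally show ?thesis .
qed

text \<open>The hypotheses compare the distribution of \<open>F\<close> under \<open>\<mu>\<close> with that of the identity under \<open>A\<close>
  times Lebesgue measure on \<open>(0, Y)\<close>: \<open>F\<close> is small on at most as much mass, and the total mass is
  no larger. A negative power is largest where \<open>F\<close> is small, so its integral is at most
  \<open>A\<close> times the integral of \<open>y powr (\<alpha> - 1)\<close> over \<open>(0, Y)\<close>. The comparison is made level by level,
  by writing the integrand as the length of the interval of levels \<open>l\<close> below it.\<close>

lemma nn_integral_powr_le_of_sublevel:
  fixes F :: "'a \<Rightarrow> real"
  assumes [measurable]: "F \<in> borel_measurable \<mu>"
    and pos: "\<And>x. x \<in> space \<mu> \<Longrightarrow> 0 < F x"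
    and \<alpha>: "0 < \<alpha>" "\<alpha> < 1" and A: "0 \<le> A" and Y: "0 < Y"
    and total: "emeasure \<mu> (space \<mu>) \<le> ennreal (A * Y)"
    and sublevel: "\<And>s. 0 < s \<Longrightarrow> emeasure \<mu> {x \<in> space \<mu>. F x \<le> s} \<le> ennreal (A * s)"
  shows "(\<integral>\<^sup>+x. ennreal (F x powr (\<alpha> - 1)) \<partial>\<mu>) \<le> ennreal (A * Y powr \<alpha> / \<alpha>)"
proof -
  interpret finite_measure \<mu>
    using total by (intro finite_measureI) (auto simp: top_unique)
  interpret pair_sigma_finite lborel \<mu> ..
  define \<beta> where "\<beta> = 1 / (1 - \<alpha>)"
  define l0 where "l0 = Y powr (\<alpha> - 1)"
  \<comment> \<open>The level \<open>l\<close> is exceeded where \<open>F < l powr - \<beta>\<close>; up to the level \<open>l0\<close> the total mass is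
    the better bound, beyond it the mass of the sublevel set.\<close>
  have \<beta>: "\<beta> > 1" "(\<alpha> - 1) * - \<beta> = 1" "(\<alpha> - 1) * (1 - \<beta>) = \<alpha>" "1 / (\<beta> - 1) = (1 - \<alpha>) / \<alpha>"
    using \<alpha> by (auto simp: \<beta>_def field_simps)
  have l0: "0 < l0" using Y by (simp add: l0_def)
  have "(\<integral>\<^sup>+x. ennreal (F x powr (\<alpha> - 1)) \<partial>\<mu>)
      = (\<integral>\<^sup>+x. (\<integral>\<^sup>+l. (if 0 < l \<and> l < F x powr (\<alpha> - 1) then 1 else 0) \<partial>lborel) \<partial>\<mu>)"
  proof (rule nn_integral_cong)
    fix x
    have "(\<integral>\<^sup>+l. (if 0 < l \<and> l < F x powr (\<alpha> - 1) then 1 else 0) \<partial>lborel)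
        = (\<integral>\<^sup>+l. indicator {0<..<F x powr (\<alpha> - 1)} l \<partial>lborel)"
      by (intro nn_integral_cong) (auto split: split_indicator)
    then show "ennreal (F x powr (\<alpha> - 1))
        = (\<integral>\<^sup>+l. (if 0 < l \<and> l < F x powr (\<alpha> - 1) then 1 else 0) \<partial>lborel)"
      by simp
  qed
  also have "\<dots> = (\<integral>\<^sup>+l. (\<integral>\<^sup>+x. (if 0 < l \<and> l < F x powr (\<alpha> - 1) then 1 else 0) \<partial>\<mu>) \<partial>lborel)"
    by (rule Fubini') measurable
  also have "\<dots> \<le> (\<integral>\<^sup>+l. ennreal (A * Y) * indicator {0<..<l0} l +
      ennreal (A * l powr - \<beta>) * indicator {l0..} l \<partial>lborel)"
  proof (rule nn_integral_mono)
    fix l :: real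
    let ?S = "{x \<in> space \<mu>. 0 < l \<and> l < F x powr (\<alpha> - 1)}"
    have "(\<integral>\<^sup>+x. (if 0 < l \<and> l < F x powr (\<alpha> - 1) then 1 else 0) \<partial>\<mu>)
        = (\<integral>\<^sup>+x. indicator ?S x \<partial>\<mu>)"
      by (intro nn_integral_cong) (auto split: split_indicator)
    also have "\<dots> = emeasure \<mu> ?S"
      by simp
    also have "\<dots> \<le> ennreal (A * Y) * indicator {0<..<l0} l +
        ennreal (A * l powr - \<beta>) * indicator {l0..} l"
    proof -
      consider "l \<le> 0" | "0 < l" "l < l0" | "l0 \<le> l" by linarith
      then show ?thesis
      proof cases
        case 1 then show ?thesis by auto
      next
        case 2
        have "emeasure \<mu> ?S \<le> emeasure \<mu> (space \<mu>)"
          by (intro emeasure_mono) auto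
        with 2 total show ?thesis by (simp add: order_trans)
      next
        case 3
        have "F x \<le> l powr - \<beta>" if "x \<in> ?S" for x
        proof -
          have "(F x powr (\<alpha> - 1)) powr - \<beta> \<le> l powr - \<beta>"
            using that \<beta> by (intro powr_mono2') auto
          then show ?thesis
            using \<beta> pos[of x] that by (simp add: powr_powr)
        qed
        then have "emeasure \<mu> ?S \<le> emeasure \<mu> {x \<in> space \<mu>. F x \<le> l powr - \<beta>}"
          by (intro emeasure_mono) auto
        also have "\<dots> \<le> ennreal (A * l powr - \<beta>)"
          using 3 l0 by (intro sublevel) auto
        finally show ?thesis using 3 by simp
      qed
    qed
    finally show "(\<integral>\<^sup>+x. (if 0 < l \<and> l < F x powr (\<alpha> - 1) then 1 else 0) \<partial>\<mu>)
      \<le> ennreal (A * Y) * indicator {0<..<l0} l + ennreal (A * l powr - \<beta>) * indicator {l0..} l" .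
  qed
  also have "\<dots> = ennreal (A * Y) * ennreal l0 +
      (\<integral>\<^sup>+l. ennreal (A * l powr - \<beta>) * indicator {l0..} l \<partial>lborel)"
    using l0 by (subst nn_integral_add) (auto simp: nn_integral_cmult_indicator)
  also have "(\<integral>\<^sup>+l. ennreal (A * l powr - \<beta>) * indicator {l0..} l \<partial>lborel)
      = ennreal (0 - (- A / (\<beta> - 1) * l0 powr (1 - \<beta>)))"
  proof (rule nn_integral_FTC_atLeast)
    show "((\<lambda>l. - A / (\<beta> - 1) * l powr (1 - \<beta>)) has_real_derivative A * l powr - \<beta>) (at l)"
      if "l0 \<le> l" for l
    proof -
      have "((\<lambda>l. l powr (1 - \<beta>)) has_real_derivative (1 - \<beta>) * l powr - \<beta>) (at l)"
        using has_real_derivative_powr[of l "1 - \<beta>"] that l0 by simp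
      from DERIV_cmult[OF this, of "- A / (\<beta> - 1)"]
      have "((\<lambda>l. - A / (\<beta> - 1) * l powr (1 - \<beta>)) has_real_derivative
          - A / (\<beta> - 1) * ((1 - \<beta>) * l powr - \<beta>)) (at l)" .
      moreover have "- A / (\<beta> - 1) * ((1 - \<beta>) * l powr - \<beta>) = A * l powr - \<beta>"
      proof -
        define d where "d = \<beta> - 1"
        have "d \<noteq> 0" "1 - \<beta> = - d" using \<beta>(1) by (auto simp: d_def)
        then have "- A / (\<beta> - 1) * (1 - \<beta>) = A"
          unfolding d_def[symmetric] by simp
        then show ?thesis by (metis mult.assoc)
      qed
      ultimately show ?thesis by (simp only:)
    qed
    have "((\<lambda>l. - A / (\<beta> - 1) * l powr (1 - \<beta>)) \<longlongrightarrow> - A / (\<beta> - 1) * 0) at_top"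
      using \<beta> by (intro tendsto_mult tendsto_const tendsto_neg_powr filterlim_ident) auto
    then show "((\<lambda>l. - A / (\<beta> - 1) * l powr (1 - \<beta>)) \<longlongrightarrow> 0) at_top" by simp
  qed (use A in auto)
  also have "ennreal (A * Y) * ennreal l0 + ennreal (0 - (- A / (\<beta> - 1) * l0 powr (1 - \<beta>)))
      = ennreal (A * Y * l0 + A / (\<beta> - 1) * l0 powr (1 - \<beta>))"
    using A Y l0 \<beta> by (simp add: ennreal_mult[symmetric] ennreal_plus[symmetric] del: ennreal_plus)
  also have "A * Y * l0 + A / (\<beta> - 1) * l0 powr (1 - \<beta>)
      = A * Y powr \<alpha> + A * (1 / (\<beta> - 1)) * Y powr \<alpha>"
    using Y \<beta>(3) powr_add[of Y 1 "\<alpha> - 1"] by (simp add: l0_def powr_powr)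
  also have "\<dots> = A * Y powr \<alpha> / \<alpha>"
    using \<alpha> unfolding \<beta>(4) by (simp add: field_simps)
  finally show ?thesis .
qed

lemma null_singleton_density:
  assumes "0 < a" and [measurable]: "u \<in> borel_measurable half_lebesgue"
  shows "{a} \<in> null_sets (density half_lebesgue u)"
proof -
  have "{a} \<in> null_sets half_lebesgue"
    using assms by (simp add: null_sets_restrict_space)
  then show ?thesis
    using absolutely_continuousI_density[OF assms(2)] by (auto simp: absolutely_continuous_def)
qed

text \<open>For \<open>u = - W'\<close> with \<open>W\<close> vanishing at infinity, and \<open>A = 1\<close>, this is the chain rule and an
  equality. Domination of the tails of \<open>u\<close>
  by \<open>W\<close> suffices for an inequality: the sublevel sets of the decreasing \<open>W\<close> are tails, so their
  mass is bounded by \<open>A\<close> times the level.\<close>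

lemma tail_power_rule:
  fixes u :: "real \<Rightarrow> ennreal" and W :: "real \<Rightarrow> real"
  assumes [measurable]: "u \<in> borel_measurable half_lebesgue" "W \<in> borel_measurable half_lebesgue"
    and pos: "\<And>x. 0 < x \<Longrightarrow> 0 < W x"
    and antimono: "\<And>x y. 0 < x \<Longrightarrow> x \<le> y \<Longrightarrow> W y \<le> W x"
    and tail: "\<And>t. 0 < t \<Longrightarrow> (\<integral>\<^sup>+x\<in>{t<..}. u x \<partial>half_lebesgue) \<le> ennreal (A * W t)"
    and A: "0 \<le> A" and \<alpha>: "0 < \<alpha>" "\<alpha> < 1" and t: "0 < t"
  shows "(\<integral>\<^sup>+x\<in>{t<..}. u x * ennreal (W x powr (\<alpha> - 1)) \<partial>half_lebesgue)
           \<le> ennreal (A * W t powr \<alpha> / \<alpha>)"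
proof -
  define \<mu> where "\<mu> = density half_lebesgue (\<lambda>x. u x * indicator {t<..} x)"
  have sp [simp]: "space \<mu> = {0<..}" and se [simp, measurable_cong]: "sets \<mu> = sets half_lebesgue"
    by (auto simp: \<mu>_def)
  have tail_\<mu>: "emeasure \<mu> {x \<in> space half_lebesgue. s < x} \<le> ennreal (A * W s)" if "0 < s" for s
  proof -
    have [measurable]: "{x \<in> space half_lebesgue. s < x} \<in> sets half_lebesgue" by measurable
    have "emeasure \<mu> {x \<in> space half_lebesgue. s < x} \<le> (\<integral>\<^sup>+x\<in>{s<..}. u x \<partial>half_lebesgue)"
      unfolding \<mu>_def
      by (subst emeasure_density) (measurable, auto intro!: nn_integral_mono split: split_indicator)
    also have "\<dots> \<le> ennreal (A * W s)" by (rule tail[OF that])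
    finally show ?thesis .
  qed
  have "(\<integral>\<^sup>+x\<in>{t<..}. u x * ennreal (W x powr (\<alpha> - 1)) \<partial>half_lebesgue)
      = (\<integral>\<^sup>+x. ennreal (W x powr (\<alpha> - 1)) \<partial>\<mu>)"
    unfolding \<mu>_def by (subst nn_integral_density) (auto simp: mult_ac)
  also have "\<dots> \<le> ennreal (A * W t powr \<alpha> / \<alpha>)"
  proof (rule nn_integral_powr_le_of_sublevel[OF _ _ \<alpha> A pos[OF t]])
    show "W \<in> borel_measurable \<mu>" by measurable
    show "0 < W x" if "x \<in> space \<mu>" for x using that pos by simp
    have "emeasure \<mu> (space \<mu>) = (\<integral>\<^sup>+x\<in>{t<..}. u x \<partial>half_lebesgue)"
      unfolding \<mu>_def by (subst emeasure_density) (auto intro!: nn_integral_cong split: split_indicator)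
    with tail[OF t] show "emeasure \<mu> (space \<mu>) \<le> ennreal (A * W t)" by simp
    fix s :: real assume s: "0 < s"
    define S where "S = {x. t < x \<and> W x \<le> s}"
    define E where "E = {x \<in> space \<mu>. W x \<le> s}"
    have E_sets: "E \<in> sets \<mu>"
      unfolding E_def by measurable
    have "{x \<in> space half_lebesgue. t < x} \<in> sets half_lebesgue" by measurable
    with E_sets have "E \<inter> {x \<in> space half_lebesgue. t < x} \<in> sets \<mu>" by (simp add: sets.Int)
    then have "emeasure \<mu> E \<le> emeasure \<mu> (E \<inter> {x \<in> space half_lebesgue. t < x})"
      using E_sets unfolding \<mu>_def
      by (subst (1 2) emeasure_density)
         (auto intro!: nn_integral_mono split: split_indicator)
    also have "\<dots> \<le> ennreal (A * s)"
    proof (cases "S = {}")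
      case True
      then have "E \<inter> {x \<in> space half_lebesgue. t < x} = {}"
        by (auto simp: S_def E_def)
      then show ?thesis by simp
    next
      case False
      define a where "a = Inf S"
      have bdd: "bdd_below S" by (rule bdd_belowI[of _ t]) (auto simp: S_def)
      have a: "t \<le> a" using False unfolding a_def by (intro cInf_greatest) (auto simp: S_def)
      show ?thesis
      proof (rule emeasure_le_of_increasing_cover)
        let ?I = "\<lambda>n. {x \<in> space half_lebesgue. a + 1 / real (Suc n) < x}"
        show "incseq ?I"
        proof (rule incseq_SucI)
          fix n
          have "1 / real (Suc (Suc n)) \<le> 1 / real (Suc n)" by (simp add: field_simps)
          then show "?I n \<subseteq> ?I (Suc n)" by auto
        qed
        show "?I n \<in> sets \<mu>" for n by measurable
        show "{a} \<in> null_sets \<mu>"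
          unfolding \<mu>_def using a t by (intro null_singleton_density) auto
        show "E \<inter> {x \<in> space half_lebesgue. t < x} \<subseteq> {a} \<union> (\<Union>n. ?I n)"
        proof
          fix x assume "x \<in> E \<inter> {x \<in> space half_lebesgue. t < x}"
          then have x: "x \<in> S" "0 < x" by (auto simp: S_def E_def)
          then have "a \<le> x" unfolding a_def using bdd by (intro cInf_lower)
          moreover have "\<exists>n. a + 1 / real (Suc n) < x" if "a < x"
            using reals_Archimedean[of "x - a"] that by (auto simp: inverse_eq_divide field_simps)
          ultimately show "x \<in> {a} \<union> (\<Union>n. ?I n)"
            using x by (cases "a = x") auto
        qed
        fix n
        obtain y where y: "y \<in> S" "y < a + 1 / real (Suc n)"
          using cInf_lessD[OF False, of "a + 1 / real (Suc n)"] by (auto simp: a_def)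
        have "emeasure \<mu> (?I n) \<le> ennreal (A * W (a + 1 / real (Suc n)))"
          using a t by (intro tail_\<mu>) (auto intro!: add_pos_pos)
        also have "\<dots> \<le> ennreal (A * s)"
          using y t A antimono[of y "a + 1 / real (Suc n)"]
          by (intro ennreal_leI mult_left_mono) (auto simp: S_def)
        finally show "emeasure \<mu> (?I n) \<le> ennreal (A * s)" .
      qed
    qed
    finally show "emeasure \<mu> {x \<in> space \<mu>. W x \<le> s} \<le> ennreal (A * s)" by (simp add: E_def)
  qed
  finally show ?thesis .
qed

text \<open>The mirror image of the preceding lemma for increasing \<open>V\<close>, whose sublevel sets are heads.\<close>

lemma head_power_rule:
  fixes u :: "real \<Rightarrow> ennreal" and V :: "real \<Rightarrow> real"
  assumes [measurable]: "u \<in> borel_measurable half_lebesgue" "V \<in> borel_measurable half_lebesgue"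
    and pos: "\<And>x. 0 < x \<Longrightarrow> 0 < V x"
    and mono: "\<And>x y. 0 < x \<Longrightarrow> x \<le> y \<Longrightarrow> V x \<le> V y"
    and head: "\<And>t. 0 < t \<Longrightarrow> (\<integral>\<^sup>+x\<in>{..<t}. u x \<partial>half_lebesgue) \<le> ennreal (A * V t)"
    and A: "0 \<le> A" and \<alpha>: "0 < \<alpha>" "\<alpha> < 1" and t: "0 < t"
  shows "(\<integral>\<^sup>+x\<in>{..<t}. u x * ennreal (V x powr (\<alpha> - 1)) \<partial>half_lebesgue)
           \<le> ennreal (A * V t powr \<alpha> / \<alpha>)"
proof -
  define \<mu> where "\<mu> = density half_lebesgue (\<lambda>x. u x * indicator {..<t} x)"
  have sp [simp]: "space \<mu> = {0<..}" and se [simp, measurable_cong]: "sets \<mu> = sets half_lebesgue"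
    by (auto simp: \<mu>_def)
  have head_\<mu>: "emeasure \<mu> {x \<in> space half_lebesgue. x < s} \<le> ennreal (A * V s)" if "0 < s" for s
  proof -
    have [measurable]: "{x \<in> space half_lebesgue. x < s} \<in> sets half_lebesgue" by measurable
    have "emeasure \<mu> {x \<in> space half_lebesgue. x < s} \<le> (\<integral>\<^sup>+x\<in>{..<s}. u x \<partial>half_lebesgue)"
      unfolding \<mu>_def
      by (subst emeasure_density) (measurable, auto intro!: nn_integral_mono split: split_indicator)
    also have "\<dots> \<le> ennreal (A * V s)" by (rule head[OF that])
    finally show ?thesis .
  qed
  have "(\<integral>\<^sup>+x\<in>{..<t}. u x * ennreal (V x powr (\<alpha> - 1)) \<partial>half_lebesgue)
      = (\<integral>\<^sup>+x. ennreal (V x powr (\<alpha> - 1)) \<partial>\<mu>)"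
    unfolding \<mu>_def by (subst nn_integral_density) (auto simp: mult_ac)
  also have "\<dots> \<le> ennreal (A * V t powr \<alpha> / \<alpha>)"
  proof (rule nn_integral_powr_le_of_sublevel[OF _ _ \<alpha> A pos[OF t]])
    show "V \<in> borel_measurable \<mu>" by measurable
    show "0 < V x" if "x \<in> space \<mu>" for x using that pos by simp
    have "emeasure \<mu> (space \<mu>) = (\<integral>\<^sup>+x\<in>{..<t}. u x \<partial>half_lebesgue)"
      unfolding \<mu>_def by (subst emeasure_density) (auto intro!: nn_integral_cong split: split_indicator)
    with head[OF t] show "emeasure \<mu> (space \<mu>) \<le> ennreal (A * V t)" by simp
    fix s :: real assume s: "0 < s"
    define S where "S = {x. 0 < x \<and> x < t \<and> V x \<le> s}"
    define E where "E = {x \<in> space \<mu>. V x \<le> s}"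
    have E_sets: "E \<in> sets \<mu>"
      unfolding E_def by measurable
    have "{x \<in> space half_lebesgue. x < t} \<in> sets half_lebesgue" by measurable
    with E_sets have "E \<inter> {x \<in> space half_lebesgue. x < t} \<in> sets \<mu>" by (simp add: sets.Int)
    then have "emeasure \<mu> E \<le> emeasure \<mu> (E \<inter> {x \<in> space half_lebesgue. x < t})"
      using E_sets unfolding \<mu>_def
      by (subst (1 2) emeasure_density)
         (auto intro!: nn_integral_mono split: split_indicator)
    also have "\<dots> \<le> ennreal (A * s)"
    proof (cases "S = {}")
      case True
      then have "E \<inter> {x \<in> space half_lebesgue. x < t} = {}"
        by (auto simp: S_def E_def)
      then show ?thesis by simp
    next
      case False
      define b where "b = Sup S"
      have bdd: "bdd_above S" by (rule bdd_aboveI[of _ t]) (auto simp: S_def)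
      have b: "0 < b" using False bdd unfolding b_def
        by (auto simp: S_def less_cSup_iff)
      show ?thesis
      proof (rule emeasure_le_of_increasing_cover)
        \<comment> \<open>These points increase to \<open>b\<close> without leaving the half-line.\<close>
        let ?c = "\<lambda>n. b - b / real (Suc (Suc n))"
        let ?I = "\<lambda>n. {x \<in> space half_lebesgue. x < ?c n}"
        show "incseq ?I"
        proof (rule incseq_SucI)
          fix n
          have "b / real (Suc (Suc (Suc n))) \<le> b / real (Suc (Suc n))"
            using b by (intro divide_left_mono) auto
          then show "?I n \<subseteq> ?I (Suc n)" by auto
        qed
        show "?I n \<in> sets \<mu>" for n by measurable
        show "{b} \<in> null_sets \<mu>"
          unfolding \<mu>_def using b by (intro null_singleton_density) auto
        show "E \<inter> {x \<in> space half_lebesgue. x < t} \<subseteq> {b} \<union> (\<Union>n. ?I n)"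
        proof
          fix x assume "x \<in> E \<inter> {x \<in> space half_lebesgue. x < t}"
          then have x: "x \<in> S" "0 < x" by (auto simp: S_def E_def)
          then have "x \<le> b" unfolding b_def using bdd by (intro cSup_upper)
          moreover have "\<exists>n. x < ?c n" if "x < b"
          proof -
            have "0 < (b - x) / b" using that b by simp
            then obtain n where "inverse (real (Suc n)) < (b - x) / b"
              using reals_Archimedean by blast
            moreover have "inverse (real (Suc (Suc n))) \<le> inverse (real (Suc n))"
              by (intro le_imp_inverse_le) auto
            ultimately have "inverse (real (Suc (Suc n))) < (b - x) / b" by linarith
            then have "inverse (real (Suc (Suc n))) * b < b - x"
              by (subst (asm) pos_less_divide_eq[OF b])
            then have "x < ?c n" by (simp add: divide_inverse mult.commute)
            then show ?thesis by blast
          qed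
          ultimately show "x \<in> {b} \<union> (\<Union>n. ?I n)"
            using x by (cases "b = x") auto
        qed
        fix n
        have c: "0 < ?c n" "?c n < b" using b by (auto simp: field_simps add_pos_nonneg)
        obtain y where y: "y \<in> S" "?c n < y"
          using less_cSupD[OF False, of "?c n"] c by (auto simp: b_def)
        have "emeasure \<mu> (?I n) \<le> ennreal (A * V (?c n))"
          using c by (intro head_\<mu>) auto
        also have "\<dots> \<le> ennreal (A * s)"
          using y c A mono[of "?c n" y]
          by (intro ennreal_leI mult_left_mono) (auto simp: S_def)
        finally show "emeasure \<mu> (?I n) \<le> ennreal (A * s)" .
      qed
    qed
    finally show "emeasure \<mu> {x \<in> space \<mu>. V x \<le> s} \<le> ennreal (A * s)" by (simp add: E_def)
  qed
  finally show ?thesis .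
qed


section \<open>Weights with finite Copson-Muckenhoupt product\<close>

locale copson_weight =
  fixes p q :: real and v :: "real \<Rightarrow> real"
  assumes p: "p > 1" and q: "q = p / (p - 1)"
    and v_measurable [measurable]: "v \<in> borel_measurable half_lebesgue"
    and v_pos: "AE x in half_lebesgue. 0 < v x"
    and product_finite: "\<And>t. 0 < t \<Longrightarrow> Mstar_product p v t < top"
begin

lemmas exponents = conjugate_exponents[OF p q]

definition w :: "real \<Rightarrow> real" where "w x = v x powr (1 - q) / x powr q"
definition V :: "real \<Rightarrow> real" where "V t = enn2real (\<integral>\<^sup>+x\<in>{..<t}. ennreal (v x) \<partial>half_lebesgue)"
definition W :: "real \<Rightarrow> real" where "W t = enn2real (\<integral>\<^sup>+x\<in>{t<..}. ennreal (w x) \<partial>half_lebesgue)"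

lemma w_measurable [measurable]: "w \<in> borel_measurable half_lebesgue"
  unfolding w_def by measurable

lemma w_nonneg: "0 \<le> w x"
  by (simp add: w_def)

lemma AE_pos: "AE x in half_lebesgue. 0 < x \<and> 0 < v x"
  using v_pos AE_space by eventually_elim simp

lemma Mstar_product_half_lebesgue:
  assumes "0 < t"
  shows "Mstar_product p v t =
    (\<integral>\<^sup>+x\<in>{..<t}. ennreal (v x) \<partial>half_lebesgue) ennpowr (1 / p) *
    (\<integral>\<^sup>+x\<in>{t<..}. ennreal (w x) \<partial>half_lebesgue) ennpowr (1 / q)"
  using assms
  by (simp add: Mstar_product_def nn_integral_Ioo_half_lebesgue nn_integral_Ioi_half_lebesgue
      conj_exp_def w_def q[symmetric])

lemma head_nonzero: "0 < t \<Longrightarrow> (\<integral>\<^sup>+x\<in>{..<t}. ennreal (v x) \<partial>half_lebesgue) \<noteq> 0"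
  using v_pos by (intro nn_integral_pos_of_AE_pos[of _ 0 t]) auto

lemma tail_nonzero: "0 < t \<Longrightarrow> (\<integral>\<^sup>+x\<in>{t<..}. ennreal (w x) \<partial>half_lebesgue) \<noteq> 0"
proof (rule nn_integral_pos_of_AE_pos[of _ t "t + 1"])
  show "AE x in half_lebesgue. 0 < w x"
    using AE_pos by eventually_elim (simp add: w_def)
qed auto

text \<open>Both factors of the product are nonzero, so finiteness of the product makes each of them finite;
  this is what allows \<open>V\<close> and \<open>W\<close> to be real-valued.\<close>

lemma head_eq: assumes "0 < t"
  shows "(\<integral>\<^sup>+x\<in>{..<t}. ennreal (v x) \<partial>half_lebesgue) = ennreal (V t)"
  using product_finite[OF assms] tail_nonzero[OF assms] unfolding V_def
  by (auto simp: Mstar_product_half_lebesgue[OF assms] less_top[symmetric] ennreal_mult_eq_top_iff)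

lemma tail_eq: assumes "0 < t"
  shows "(\<integral>\<^sup>+x\<in>{t<..}. ennreal (w x) \<partial>half_lebesgue) = ennreal (W t)"
  using product_finite[OF assms] head_nonzero[OF assms] unfolding W_def
  by (auto simp: Mstar_product_half_lebesgue[OF assms] less_top[symmetric] ennreal_mult_eq_top_iff)

lemma V_pos: "0 < t \<Longrightarrow> 0 < V t"
  using head_nonzero[of t] head_eq[of t] by (simp add: ennreal_eq_0_iff not_le)

lemma W_pos: "0 < t \<Longrightarrow> 0 < W t"
  using tail_nonzero[of t] tail_eq[of t] by (simp add: ennreal_eq_0_iff not_le)

lemma V_mono: assumes "0 < x" "x \<le> y" shows "V x \<le> V y"
proof -
  have "ennreal (V x) \<le> ennreal (V y)"
    using assms by (subst (1 2) head_eq[symmetric])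
       (auto intro!: nn_integral_mono split: split_indicator)
  then show ?thesis using V_pos[of y] assms by (simp add: ennreal_le_iff)
qed

lemma W_antimono: assumes "0 < x" "x \<le> y" shows "W y \<le> W x"
proof -
  have "ennreal (W y) \<le> ennreal (W x)"
    using assms by (subst (1 2) tail_eq[symmetric])
       (auto intro!: nn_integral_mono split: split_indicator)
  then show ?thesis using W_pos[of x] assms by (simp add: ennreal_le_iff)
qed

lemma V_measurable [measurable]: "V \<in> borel_measurable half_lebesgue"
  unfolding V_def by measurable

lemma W_measurable [measurable]: "W \<in> borel_measurable half_lebesgue"
  unfolding W_def by measurable

lemma Mstar_product_eq:
  "0 < t \<Longrightarrow> Mstar_product p v t = ennreal (V t powr (1 / p) * W t powr (1 / q))"
  using V_pos[of t] W_pos[of t]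
  by (simp add: Mstar_product_half_lebesgue head_eq tail_eq ennpowr_ennreal ennreal_mult)

lemma Cop_norm_eq:
  "Cop_norm p v h = (\<integral>\<^sup>+t. (\<integral>\<^sup>+x\<in>{t<..}. ennreal (\<bar>h x\<bar> / x) \<partial>half_lebesgue) ennpowr p * ennreal (v t)
     \<partial>half_lebesgue) ennpowr (1 / p)"
  unfolding Cop_norm_def nn_integral_half_line
  by (intro arg_cong[where f = "\<lambda>x. x ennpowr (1 / p)"] nn_integral_cong)
     (simp add: nn_integral_Ioi_half_lebesgue)

lemma Lp_norm_eq:
  "Lp_norm p v f = (\<integral>\<^sup>+x. ennreal (\<bar>f x\<bar> powr p * v x) \<partial>half_lebesgue) ennpowr (1 / p)"
  unfolding Lp_norm_def nn_integral_half_line ..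

lemma Gstar_norm_eq:
  "Gstar_norm q (\<lambda>x. v x powr (1 - q)) g =
    (SUP t \<in> {0<..}. (1 / ennreal (W t) *
       (\<integral>\<^sup>+x\<in>{t<..}. ennreal (\<bar>g x\<bar> powr q * w x) \<partial>half_lebesgue)) ennpowr (1 / q))"
proof -
  have "(\<integral>\<^sup>+x\<in>{t<..}. ennreal (v x powr (1 - q) * x powr - q) \<partial>lebesgue) = ennreal (W t)"
    "(\<integral>\<^sup>+x\<in>{t<..}. ennreal (\<bar>g x\<bar> powr q * v x powr (1 - q) * x powr - q) \<partial>lebesgue)
      = (\<integral>\<^sup>+x\<in>{t<..}. ennreal (\<bar>g x\<bar> powr q * w x) \<partial>half_lebesgue)" if "0 < t" for t
    using that tail_eq[of t]
    by (simp_all add: nn_integral_Ioi_half_lebesgue w_def powr_minus divide_inverse mult.assoc)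
  then show ?thesis
    unfolding Gstar_norm_def by (intro SUP_cong) auto
qed

lemma tail_le_of_Gstar_norm:
  assumes "Gstar_norm q (\<lambda>x. v x powr (1 - q)) g \<le> ennreal G" "0 \<le> G" "0 < t"
  shows "(\<integral>\<^sup>+x\<in>{t<..}. ennreal (\<bar>g x\<bar> powr q * w x) \<partial>half_lebesgue) \<le> ennreal (G powr q * W t)"
proof -
  let ?I = "\<integral>\<^sup>+x\<in>{t<..}. ennreal (\<bar>g x\<bar> powr q * w x) \<partial>half_lebesgue"
  have "(1 / ennreal (W t) * ?I) ennpowr (1 / q) \<le> ennreal G"
    using assms unfolding Gstar_norm_eq by (simp add: SUP_le_iff)
  then have "((1 / ennreal (W t) * ?I) ennpowr (1 / q)) ennpowr q \<le> ennreal G ennpowr q"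
    using exponents by (intro ennpowr_mono) auto
  then have "1 / ennreal (W t) * ?I \<le> ennreal (G powr q)"
    using exponents(1) assms(2) by (simp add: ennpowr_ennpowr ennpowr_ennreal)
  then have "ennreal (W t) * (1 / ennreal (W t) * ?I) \<le> ennreal (W t) * ennreal (G powr q)"
    by (intro mult_left_mono) auto
  moreover have "ennreal (W t) * (1 / ennreal (W t) * ?I) = ?I"
    using W_pos[OF assms(3)]
    by (simp add: mult.assoc[symmetric] ennreal_times_divide ennreal_divide_self)
  ultimately show ?thesis
    using W_pos[OF assms(3)] by (simp add: ennreal_mult mult.commute)
qed

lemma Gstar_norm_le_of_tail:
  assumes "\<And>t. 0 < t \<Longrightarrow>
      (\<integral>\<^sup>+x\<in>{t<..}. ennreal (\<bar>g x\<bar> powr q * w x) \<partial>half_lebesgue) \<le> ennreal (G powr q * W t)"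
    and "0 \<le> G"
  shows "Gstar_norm q (\<lambda>x. v x powr (1 - q)) g \<le> ennreal G"
  unfolding Gstar_norm_eq
proof (rule SUP_least)
  fix t :: real assume "t \<in> {0<..}"
  then have t: "0 < t" by simp
  let ?I = "\<integral>\<^sup>+x\<in>{t<..}. ennreal (\<bar>g x\<bar> powr q * w x) \<partial>half_lebesgue"
  have "1 / ennreal (W t) * ?I \<le> 1 / ennreal (W t) * ennreal (G powr q * W t)"
    using assms(1)[OF t] by (intro mult_left_mono) auto
  also have "\<dots> = ennreal (G powr q)"
    using W_pos[OF t]
    by (simp add: ennreal_mult ennreal_divide_times ennreal_times_divide mult.commute
        ennreal_mult_divide_eq)
  finally have "(1 / ennreal (W t) * ?I) ennpowr (1 / q) \<le> ennreal (G powr q) ennpowr (1 / q)"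
    using exponents(1) by (intro ennpowr_mono) auto
  also have "\<dots> = ennreal G"
    using assms exponents(1) by (simp add: ennpowr_ennreal powr_powr)
  finally show "(1 / ennreal (W t) * ?I) ennpowr (1 / q) \<le> ennreal G" .
qed


section \<open>Hardy's inequality for products\<close>

text \<open>The factor \<open>W powr (1 / (p * q))\<close>, attached to \<open>f\<close> and divided out of \<open>g\<close> before Hoelder's inequality, is the one
  for which the powers \<open>1 / q - 1\<close> of \<open>W\<close> and \<open>1 / p - 1\<close> of \<open>V\<close> appear in the two subsequent
  integrations; they contribute the factors \<open>q\<close> and \<open>p\<close> of the constant.\<close>

lemma Cop_norm_le_of_factorization:
  assumes [measurable]: "f \<in> borel_measurable half_lebesgue" "g \<in> borel_measurable half_lebesgue"
    and C: "\<And>t. 0 < t \<Longrightarrow> V t powr (1 / p) * W t powr (1 / q) \<le> C"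
    and G: "0 \<le> G" "Gstar_norm q (\<lambda>x. v x powr (1 - q)) g \<le> ennreal G"
    and h: "AE x in half_lebesgue. h x = f x * g x"
  shows "Cop_norm p v h \<le> ennreal (q powr (1 / q) * p powr (1 / p) * C * G) * Lp_norm p v f"
proof -
  note e = exponents
  have C_pos: "0 < C"
    using C[of 1] V_pos[of 1] W_pos[of 1] by (smt (verit) mult_pos_pos powr_gt_zero)
  define a where "a x = \<bar>f x\<bar> * v x powr (1 / p) * W x powr (1 / (p * q))" for x
  define b where "b x = \<bar>g x\<bar> * v x powr (- 1 / p) / x * W x powr (- 1 / (p * q))" for x
  define \<phi> where "\<phi> x = ennreal (\<bar>f x\<bar> powr p * v x) * ennreal (W x powr (1 / q))" for x
  define K where "K = (G powr q * q * C) powr (p - 1)"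
  have K: "0 \<le> K" by (simp add: K_def)
  have [measurable]: "a \<in> borel_measurable half_lebesgue" "b \<in> borel_measurable half_lebesgue"
     "\<phi> \<in> borel_measurable half_lebesgue"
    unfolding a_def b_def \<phi>_def by measurable
  have a_powr: "AE x in half_lebesgue. ennreal (a x powr p) = \<phi> x"
    using AE_pos
  proof eventually_elim
    case (elim x)
    then have "a x powr p = \<bar>f x\<bar> powr p * v x * W x powr (1 / q)"
      using p W_pos[of x] by (simp add: a_def powr_mult powr_powr)
    then show ?case using elim by (simp add: \<phi>_def ennreal_mult)
  qed
  have b_powr: "AE x in half_lebesgue.
      ennreal (b x powr q) = ennreal (\<bar>g x\<bar> powr q * w x) * ennreal (W x powr (1 / q - 1))"
    using AE_pos
  proof eventually_elim
    case (elim x)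
    have "- 1 / p * q = 1 - q" using e(4) by simp
    moreover have "- 1 / (p * q) * q = 1 / q - 1" unfolding e(3) using e(1) by simp
    ultimately have "b x powr q = \<bar>g x\<bar> powr q * w x * W x powr (1 / q - 1)"
      using elim by (simp add: b_def w_def powr_mult powr_divide powr_powr del: divide_minus_left)
    then show ?case by (simp add: ennreal_mult w_nonneg)
  qed
  have ab: "AE x in half_lebesgue. \<bar>h x\<bar> / x = a x * b x"
    using AE_pos h
  proof eventually_elim
    case (elim x)
    then have "v x powr (1 / p) * v x powr (- 1 / p) = 1"
      "W x powr (1 / (p * q)) * W x powr (- 1 / (p * q)) = 1"
      using W_pos[of x] by (simp_all add: powr_add[symmetric])
    moreover have "a x * b x = \<bar>f x\<bar> * \<bar>g x\<bar> / x * (v x powr (1 / p) * v x powr (- 1 / p)) *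
        (W x powr (1 / (p * q)) * W x powr (- 1 / (p * q)))"
      by (simp add: a_def b_def del: divide_minus_left)
    ultimately show ?case using elim by (simp add: abs_mult)
  qed
  have inner: "(\<integral>\<^sup>+x\<in>{t<..}. ennreal (\<bar>h x\<bar> / x) \<partial>half_lebesgue) ennpowr p
      \<le> (\<integral>\<^sup>+x\<in>{t<..}. \<phi> x \<partial>half_lebesgue) * ennreal (K * V t powr (1 / p - 1))"
    if t: "0 < t" for t
  proof -
    define B where "B = G powr q * q * W t powr (1 / q)"
    have B: "0 \<le> B" using e by (simp add: B_def)
    have "(\<integral>\<^sup>+x\<in>{t<..}. ennreal (\<bar>h x\<bar> / x) \<partial>half_lebesgue)
        = (\<integral>\<^sup>+x. ennreal ((if t < x then a x else 0) * (if t < x then b x else 0)) \<partial>half_lebesgue)"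
      by (rule nn_integral_cong_AE) (use ab in \<open>eventually_elim, auto\<close>)
    also have "\<dots> ennpowr p
        \<le> (\<integral>\<^sup>+x. ennreal ((if t < x then a x else 0) powr p) \<partial>half_lebesgue) * ennreal (B powr (p - 1))"
    proof (rule nn_integral_Holder[OF _ _ _ _ p q B])
      show "0 \<le> (if t < x then a x else 0)" for x by (simp add: a_def)
      show "0 \<le> (if t < x then b x else 0)" for x using t by (simp add: b_def)
      have "(\<integral>\<^sup>+x. ennreal ((if t < x then b x else 0) powr q) \<partial>half_lebesgue)
          = (\<integral>\<^sup>+x\<in>{t<..}. ennreal (\<bar>g x\<bar> powr q * w x) * ennreal (W x powr (1 / q - 1)) \<partial>half_lebesgue)"
        by (rule nn_integral_cong_AE) (use b_powr in \<open>eventually_elim, auto\<close>)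
      also have "\<dots> \<le> ennreal (G powr q * W t powr (1 / q) / (1 / q))"
        using e(1) G t W_pos W_antimono tail_le_of_Gstar_norm[OF G(2,1)]
        by (intro tail_power_rule) auto
      also have "\<dots> = ennreal B" by (simp add: B_def mult_ac)
      finally show "(\<integral>\<^sup>+x. ennreal ((if t < x then b x else 0) powr q) \<partial>half_lebesgue) \<le> ennreal B" .
    qed measurable
    also have "(\<integral>\<^sup>+x. ennreal ((if t < x then a x else 0) powr p) \<partial>half_lebesgue)
        = (\<integral>\<^sup>+x\<in>{t<..}. \<phi> x \<partial>half_lebesgue)"
      by (rule nn_integral_cong_AE) (use a_powr in \<open>eventually_elim, auto\<close>)
    also have "ennreal (B powr (p - 1)) \<le> ennreal (K * V t powr (1 / p - 1))"
    proof (rule ennreal_leI)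
      have "W t powr (1 / q) \<le> C * V t powr (- 1 / p)"
        using C[OF t] V_pos[OF t] by (simp add: powr_minus field_simps)
      then have "B \<le> (G powr q * q * C) * V t powr (- 1 / p)"
        using e unfolding B_def by (simp add: mult.assoc mult_left_mono)
      then have "B powr (p - 1) \<le> ((G powr q * q * C) * V t powr (- 1 / p)) powr (p - 1)"
        using p B by (intro powr_mono2) auto
      also have "\<dots> = K * (V t powr (- 1 / p)) powr (p - 1)"
        unfolding K_def by (rule powr_mult)
      also have "(V t powr (- 1 / p)) powr (p - 1) = V t powr (1 / p - 1)"
      proof -
        have "- 1 / p * (p - 1) = 1 / p - 1" using p by (simp add: field_simps)
        then show ?thesis by (simp only: powr_powr)
      qed
      finally show "B powr (p - 1) \<le> K * V t powr (1 / p - 1)" .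
    qed
    finally show ?thesis by (simp add: mult_left_mono)
  qed
  have "(\<integral>\<^sup>+t. (\<integral>\<^sup>+x\<in>{t<..}. ennreal (\<bar>h x\<bar> / x) \<partial>half_lebesgue) ennpowr p * ennreal (v t)
        \<partial>half_lebesgue)
      \<le> (\<integral>\<^sup>+t. ennreal K * (ennreal (v t) * ennreal (V t powr (1 / p - 1)) *
          (\<integral>\<^sup>+x\<in>{t<..}. \<phi> x \<partial>half_lebesgue)) \<partial>half_lebesgue)"
  proof (rule nn_integral_mono)
    fix t assume "t \<in> space half_lebesgue"
    then have "0 < t" by simp
    from mult_right_mono[OF inner[OF this], of "ennreal (v t)"]
    show "(\<integral>\<^sup>+x\<in>{t<..}. ennreal (\<bar>h x\<bar> / x) \<partial>half_lebesgue) ennpowr p * ennreal (v t)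
      \<le> ennreal K * (ennreal (v t) * ennreal (V t powr (1 / p - 1)) *
          (\<integral>\<^sup>+x\<in>{t<..}. \<phi> x \<partial>half_lebesgue))"
      using K by (simp add: ennreal_mult mult_ac)
  qed
  also have "\<dots> = ennreal K * (\<integral>\<^sup>+t. ennreal (v t) * ennreal (V t powr (1 / p - 1)) *
          (\<integral>\<^sup>+x\<in>{t<..}. \<phi> x \<partial>half_lebesgue) \<partial>half_lebesgue)"
    by (rule nn_integral_cmult) measurable
  also have "(\<integral>\<^sup>+t. ennreal (v t) * ennreal (V t powr (1 / p - 1)) *
          (\<integral>\<^sup>+x\<in>{t<..}. \<phi> x \<partial>half_lebesgue) \<partial>half_lebesgue)
      = (\<integral>\<^sup>+x. \<phi> x * (\<integral>\<^sup>+t\<in>{..<x}. ennreal (v t) * ennreal (V t powr (1 / p - 1)) \<partial>half_lebesgue)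
          \<partial>half_lebesgue)"
    by (intro nn_integral_triangle sigma_finite_half_lebesgue) measurable
  also have "\<dots> \<le> (\<integral>\<^sup>+x. ennreal (p * C) * ennreal (\<bar>f x\<bar> powr p * v x) \<partial>half_lebesgue)"
  proof (rule nn_integral_mono)
    fix x assume "x \<in> space half_lebesgue"
    then have x: "0 < x" by simp
    have "(\<integral>\<^sup>+t\<in>{..<x}. ennreal (v t) * ennreal (V t powr (1 / p - 1)) \<partial>half_lebesgue)
        \<le> ennreal (1 * V x powr (1 / p) / (1 / p))"
      using p x V_pos V_mono head_eq by (intro head_power_rule) auto
    then have "\<phi> x * (\<integral>\<^sup>+t\<in>{..<x}. ennreal (v t) * ennreal (V t powr (1 / p - 1)) \<partial>half_lebesgue)
        \<le> \<phi> x * ennreal (p * V x powr (1 / p))"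
      by (intro mult_left_mono) (auto simp: mult.commute)
    also have "\<dots> = ennreal (p * (V x powr (1 / p) * W x powr (1 / q))) * ennreal (\<bar>f x\<bar> powr p * v x)"
      using p by (simp add: \<phi>_def ennreal_mult mult_ac)
    also have "\<dots> \<le> ennreal (p * C) * ennreal (\<bar>f x\<bar> powr p * v x)"
      using p C[OF x] by (intro mult_right_mono ennreal_leI mult_left_mono) auto
    finally show "\<phi> x * (\<integral>\<^sup>+t\<in>{..<x}. ennreal (v t) * ennreal (V t powr (1 / p - 1)) \<partial>half_lebesgue)
        \<le> ennreal (p * C) * ennreal (\<bar>f x\<bar> powr p * v x)" .
  qed
  also have "\<dots> = ennreal (p * C) * (\<integral>\<^sup>+x. ennreal (\<bar>f x\<bar> powr p * v x) \<partial>half_lebesgue)"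
    by (rule nn_integral_cmult) measurable
  finally have "(\<integral>\<^sup>+t. (\<integral>\<^sup>+x\<in>{t<..}. ennreal (\<bar>h x\<bar> / x) \<partial>half_lebesgue) ennpowr p * ennreal (v t)
        \<partial>half_lebesgue)
     \<le> ennreal (K * (p * C)) * (\<integral>\<^sup>+x. ennreal (\<bar>f x\<bar> powr p * v x) \<partial>half_lebesgue)"
    using K p C_pos by (simp add: ennreal_mult mult.assoc mult_left_mono)
  then have "Cop_norm p v h
      \<le> (ennreal (K * (p * C)) * (\<integral>\<^sup>+x. ennreal (\<bar>f x\<bar> powr p * v x) \<partial>half_lebesgue)) ennpowr (1 / p)"
    unfolding Cop_norm_eq using p by (intro ennpowr_mono) auto
  also have "\<dots> = ennreal ((K * (p * C)) powr (1 / p)) * Lp_norm p v f"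
    using p K C_pos by (simp add: ennpowr_mult ennpowr_ennreal Lp_norm_eq)
  also have "(K * (p * C)) powr (1 / p) = q powr (1 / q) * p powr (1 / p) * C * G"
  proof -
    have "(p - 1) * (1 / p) = 1 / q" unfolding e(3) using p by (simp add: field_simps)
    then have "(K * (p * C)) powr (1 / p) = (G powr q * q * C) powr (1 / q) * (p * C) powr (1 / p)"
      unfolding K_def using C_pos p e
      by (subst powr_mult) (auto simp: powr_powr)
    also have "\<dots> = G * q powr (1 / q) * p powr (1 / p) * (C powr (1 / q) * C powr (1 / p))"
      using C_pos p e(1) G by (simp add: powr_mult powr_powr)
    also have "C powr (1 / q) * C powr (1 / p) = C"
      using C_pos e by (simp add: powr_add[symmetric])
    finally show ?thesis by (simp add: mult_ac)
  qed
  finally show ?thesis .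
qed


section \<open>The optimal factorization\<close>

text \<open>The point is the weight \<open>S x\<close> by which \<open>f powr p * v\<close> differs from \<open>\<bar>h x\<bar> / x\<close>. With
  \<open>V x * H x powr (p - 1)\<close> in its place the function \<open>f\<close> would have an even smaller norm, but \<open>\<bar>g\<bar> powr q * w\<close> would be \<open>\<bar>h x\<bar> / x * V x powr (1 - q) / H x\<close>; its tails need not be
  controlled by \<open>W\<close>, since \<open>\<bar>h x\<bar> / x / H x\<close> is a logarithmic derivative. The integral of
  \<open>v * H powr (p - 1)\<close> over \<open>(0, x)\<close> dominates this product and increases in \<open>x\<close>, which controls the
  tails; being an integral, it also lets Fubini's theorem give the norm of \<open>f\<close> exactly.\<close>

lemma factorization_of_Cop:
  assumes [measurable]: "h \<in> borel_measurable half_lebesgue"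
    and fin: "Cop_norm p v h < top"
    and c: "0 < c" "\<And>t. 0 < t \<Longrightarrow> c \<le> V t powr (1 / p) * W t powr (1 / q)"
  obtains f g where "f \<in> borel_measurable half_lebesgue" "g \<in> borel_measurable half_lebesgue"
    "AE x in half_lebesgue. h x = f x * g x" "Lp_norm p v f \<le> Cop_norm p v h"
    "Gstar_norm q (\<lambda>x. v x powr (1 - q)) g \<le> ennreal (1 / c)"
proof -
  note e = exponents
  define H where "H t = (\<integral>\<^sup>+x\<in>{t<..}. ennreal (\<bar>h x\<bar> / x) \<partial>half_lebesgue)" for t
  define I where "I = (\<integral>\<^sup>+t. H t ennpowr p * ennreal (v t) \<partial>half_lebesgue)"
  define S where "S x = (\<integral>\<^sup>+r\<in>{..<x}. H r ennpowr (p - 1) * ennreal (v r) \<partial>half_lebesgue)" for x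
  have [measurable]: "H \<in> borel_measurable half_lebesgue"
    unfolding H_def by measurable
  have [measurable]: "S \<in> borel_measurable half_lebesgue"
    unfolding S_def by measurable
  have Cop: "Cop_norm p v h = I ennpowr (1 / p)"
    by (simp add: Cop_norm_eq I_def H_def)
  have I_fin: "I < top" using fin unfolding Cop by simp
  have H_antimono: "H y \<le> H x" if "x \<le> y" for x y
    unfolding H_def using that by (intro nn_integral_mono) (auto split: split_indicator)
  have S_mono: "S x \<le> S y" if "x \<le> y" for x y
    unfolding S_def using that by (intro nn_integral_mono) (auto split: split_indicator)
  have head_lower: "H t ennpowr r * ennreal (V t)
      \<le> (\<integral>\<^sup>+s\<in>{..<t}. H s ennpowr r * ennreal (v s) \<partial>half_lebesgue)" if "0 < t" "0 \<le> r" for t r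
  proof -
    have "H t ennpowr r * ennreal (V t) = (\<integral>\<^sup>+s\<in>{..<t}. H t ennpowr r * ennreal (v s) \<partial>half_lebesgue)"
      using that by (simp add: head_eq[symmetric] nn_integral_cmult mult.assoc)
    also have "\<dots> \<le> (\<integral>\<^sup>+s\<in>{..<t}. H s ennpowr r * ennreal (v s) \<partial>half_lebesgue)"
      using that H_antimono
      by (intro nn_integral_mono) (auto split: split_indicator intro!: mult_right_mono ennpowr_mono)
    finally show ?thesis .
  qed
  have head_le_I: "(\<integral>\<^sup>+s\<in>{..<t}. H s ennpowr p * ennreal (v s) \<partial>half_lebesgue) \<le> I" for t
    unfolding I_def by (intro nn_integral_mono) (auto split: split_indicator)
  \<comment> \<open>\<open>H\<close> is decreasing and \<open>v\<close> has positive mass near \<open>0\<close>, so an infinite value of \<open>H\<close> would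
    make the Copson norm infinite.\<close>
  have H_fin: "H t < top" if "0 < t" for t
  proof -
    have "H t ennpowr p * ennreal (V t) < top"
      using head_lower[OF that, of p] head_le_I[of t] I_fin p by (auto intro: le_less_trans)
    then show ?thesis
      using V_pos[OF that] by (auto simp: less_top[symmetric] ennreal_mult_eq_top_iff)
  qed
  have S_fin: "S x < top" if "0 < x" for x
  proof -
    have "S x \<le> (\<integral>\<^sup>+r. ennreal (v r) * indicator {..<x} r + H r ennpowr p * ennreal (v r) \<partial>half_lebesgue)"
      unfolding S_def
    proof (intro nn_integral_mono)
      fix r assume "r \<in> space half_lebesgue"
      have "H r ennpowr (p - 1) \<le> 1 + H r ennpowr p"
      proof (cases "H r")
        case (real y)
        have "y powr (p - 1) \<le> 1 + y powr p"
        proof (cases "y \<le> 1")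
          case True
          then have "y powr (p - 1) \<le> 1" using real p by (intro powr_le1) auto
          then show ?thesis by (simp add: add_increasing2)
        next
          case False
          then have "y powr (p - 1) \<le> y powr p" by (intro powr_mono) auto
          then show ?thesis by simp
        qed
        then show ?thesis
          using real by (simp add: ennpowr_ennreal ennreal_1[symmetric] ennreal_plus[symmetric]
              ennreal_leI del: ennreal_plus ennreal_1)
      qed simp
      from mult_right_mono[OF this, of "ennreal (v r)"]
      show "H r ennpowr (p - 1) * ennreal (v r) * indicator {..<x} r
          \<le> ennreal (v r) * indicator {..<x} r + H r ennpowr p * ennreal (v r)"
        by (auto simp: algebra_simps split: split_indicator)
    qed
    also have "\<dots> = ennreal (V x) + I"
      using that unfolding I_def by (subst nn_integral_add) (auto simp: head_eq)
    also have "\<dots> < top" using I_fin by (simp add: less_top)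
    finally show ?thesis .
  qed
  show ?thesis
  \<comment> \<open>If \<open>H\<close> vanishes identically then so does \<open>h\<close>, almost everywhere. Otherwise \<open>S\<close> is positive everywhere,
    and dividing by \<open>f\<close> is legitimate wherever \<open>h\<close> does not vanish.\<close>
  proof (cases "\<forall>t>0. H t = 0")
    case True
    have "(\<integral>\<^sup>+t. ennreal (v t) * H t \<partial>half_lebesgue) = 0"
      using True by (subst nn_integral_0_iff_AE) (auto intro!: AE_I2)
    also have "(\<integral>\<^sup>+t. ennreal (v t) * H t \<partial>half_lebesgue) =
        (\<integral>\<^sup>+x. ennreal (\<bar>h x\<bar> / x) * (\<integral>\<^sup>+t\<in>{..<x}. ennreal (v t) \<partial>half_lebesgue) \<partial>half_lebesgue)"
      unfolding H_def by (intro nn_integral_triangle sigma_finite_half_lebesgue) measurable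
    finally have "AE x in half_lebesgue.
        ennreal (\<bar>h x\<bar> / x) * (\<integral>\<^sup>+t\<in>{..<x}. ennreal (v t) \<partial>half_lebesgue) = 0"
      by (subst (asm) nn_integral_0_iff_AE) auto
    with AE_pos have h0: "AE x in half_lebesgue. h x = 0"
    proof eventually_elim
      case (elim x)
      then show ?case
        using V_pos[of x] by (simp add: head_eq ennreal_eq_0_iff divide_le_0_iff)
    qed
    show ?thesis
    proof (rule that[of "\<lambda>x. 0" "\<lambda>x. 0"])
      show "Lp_norm p v (\<lambda>x. 0) \<le> Cop_norm p v h" by (simp add: Lp_norm_eq)
      show "Gstar_norm q (\<lambda>x. v x powr (1 - q)) (\<lambda>x. 0) \<le> ennreal (1 / c)"
        using c by (intro Gstar_norm_le_of_tail) auto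
    qed (use h0 in auto)
  next
    case False
    then obtain t0 where t0: "0 < t0" "H t0 \<noteq> 0" by auto
    define \<sigma> where "\<sigma> x = enn2real (S x)" for x
    have S_eq: "S x = ennreal (\<sigma> x)" if "0 < x" for x
      using S_fin[OF that] by (simp add: \<sigma>_def)
    have \<sigma>_pos: "0 < \<sigma> x" if "0 < x" for x
    proof -
      let ?y = "min x t0"
      have y: "0 < ?y" using that t0 by simp
      have "H ?y \<noteq> 0" using H_antimono[of ?y t0] t0 by auto
      then have "H ?y ennpowr (p - 1) * ennreal (V ?y) \<noteq> 0"
        using V_pos[OF y] by (simp add: ennreal_eq_0_iff)
      moreover have "H ?y ennpowr (p - 1) * ennreal (V ?y) \<le> S x"
        using head_lower[OF y, of "p - 1"] p S_mono[of ?y x] by (simp add: S_def)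
      ultimately have "S x \<noteq> 0" by auto
      then show ?thesis using S_eq[OF that] by (simp add: ennreal_eq_0_iff not_le)
    qed
    have \<sigma>_mono: "\<sigma> x \<le> \<sigma> y" if "0 < x" "x \<le> y" for x y
      using S_mono[OF that(2)] S_eq[of x] S_eq[of y] that \<sigma>_pos[of y] by (simp add: ennreal_le_iff)
    have [measurable]: "\<sigma> \<in> borel_measurable half_lebesgue"
      unfolding \<sigma>_def by measurable
    define f where "f x = (\<bar>h x\<bar> * \<sigma> x / (x * v x)) powr (1 / p)" for x
    define g where "g x = h x / f x" for x
    have [measurable]: "f \<in> borel_measurable half_lebesgue"
      unfolding f_def by measurable
    have [measurable]: "g \<in> borel_measurable half_lebesgue"
      unfolding g_def by measurable
    have f_powr: "AE x in half_lebesgue. ennreal (\<bar>f x\<bar> powr p * v x) = ennreal (\<bar>h x\<bar> / x) * S x"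
      using AE_pos
    proof eventually_elim
      case (elim x)
      then have "\<bar>f x\<bar> powr p * v x = \<bar>h x\<bar> / x * \<sigma> x"
        using p \<sigma>_pos[of x] by (simp add: f_def powr_powr)
      then show ?case
        using elim S_eq[of x] \<sigma>_pos[of x] by (simp add: ennreal_mult[symmetric])
    qed
    have g_powr: "AE x in half_lebesgue. \<bar>g x\<bar> powr q * w x = \<bar>h x\<bar> / x * \<sigma> x powr (1 - q)"
      using AE_pos
    proof eventually_elim
      case (elim x)
      show ?case
      proof (cases "h x = 0")
        case False
        define k where "k = \<bar>h x\<bar>"
        have k: "0 < k" "0 < \<sigma> x" "0 < x" "0 < v x" using False \<sigma>_pos elim by (auto simp: k_def)
        have "f x powr q = (k * \<sigma> x / (x * v x)) powr (q - 1)"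
          using e by (simp add: f_def powr_powr k_def)
        then have "\<bar>g x\<bar> powr q * w x
            = k powr q / (k * \<sigma> x / (x * v x)) powr (q - 1) * (v x powr (1 - q) / x powr q)"
        proof -
          assume f: "f x powr q = (k * \<sigma> x / (x * v x)) powr (q - 1)"
          have "\<bar>g x\<bar> = k / f x" by (simp add: g_def k_def f_def)
          then show ?thesis by (simp only: w_def powr_divide f)
        qed
        also have "\<dots> = k / x * \<sigma> x powr (1 - q)"
        \<comment> \<open>All quantities are positive, so the identity is linear in their logarithms.\<close>
        proof (rule ln_inj_iff[THEN iffD1])
          show "ln (k powr q / (k * \<sigma> x / (x * v x)) powr (q - 1) * (v x powr (1 - q) / x powr q))
              = ln (k / x * \<sigma> x powr (1 - q))"
            using k by (simp add: ln_mult ln_div ln_powr) (simp add: algebra_simps)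
        qed (use k in auto)
        finally show ?thesis by (simp add: k_def)
      qed (simp add: g_def)
    qed
    have "AE x in half_lebesgue. h x = f x * g x"
      using AE_pos
    proof eventually_elim
      case (elim x)
      then show ?case using \<sigma>_pos[of x] by (auto simp: g_def f_def)
    qed
    moreover have "Lp_norm p v f \<le> Cop_norm p v h"
    proof -
      have "(\<integral>\<^sup>+x. ennreal (\<bar>f x\<bar> powr p * v x) \<partial>half_lebesgue)
          = (\<integral>\<^sup>+x. ennreal (\<bar>h x\<bar> / x) * S x \<partial>half_lebesgue)"
        using f_powr by (rule nn_integral_cong_AE)
      also have "\<dots> = (\<integral>\<^sup>+r. H r ennpowr (p - 1) * ennreal (v r) * H r \<partial>half_lebesgue)"
        unfolding S_def H_def
        by (intro nn_integral_triangle[symmetric] sigma_finite_half_lebesgue) measurable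
      also have "\<dots> = I"
        unfolding I_def
      proof (rule nn_integral_cong)
        fix r assume "r \<in> space half_lebesgue"
        then have "H r \<noteq> top" using H_fin[of r] by simp
        from ennpowr_add[OF this, of "p - 1" 1]
        show "H r ennpowr (p - 1) * ennreal (v r) * H r = H r ennpowr p * ennreal (v r)"
          by (simp add: mult_ac)
      qed
      finally show ?thesis by (simp add: Lp_norm_eq Cop)
    qed
    moreover have "Gstar_norm q (\<lambda>x. v x powr (1 - q)) g \<le> ennreal (1 / c)"
    proof (rule Gstar_norm_le_of_tail)
      fix t :: real assume t: "0 < t"
      obtain y where y: "0 \<le> y" "H t = ennreal y"
        using H_fin[OF t] by (cases "H t") auto
      have "(\<integral>\<^sup>+x\<in>{t<..}. ennreal (\<bar>g x\<bar> powr q * w x) \<partial>half_lebesgue)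
          \<le> (\<integral>\<^sup>+x. ennreal (\<sigma> t powr (1 - q)) * (ennreal (\<bar>h x\<bar> / x) * indicator {t<..} x) \<partial>half_lebesgue)"
      proof (rule nn_integral_mono_AE)
        show "AE x in half_lebesgue. ennreal (\<bar>g x\<bar> powr q * w x) * indicator {t<..} x
            \<le> ennreal (\<sigma> t powr (1 - q)) * (ennreal (\<bar>h x\<bar> / x) * indicator {t<..} x)"
          using AE_pos g_powr
        proof eventually_elim
          case (elim x)
          show ?case
          proof (cases "t < x")
            case True
            have "\<sigma> x powr (1 - q) \<le> \<sigma> t powr (1 - q)"
              using e \<sigma>_pos[OF t] \<sigma>_mono[OF t, of x] True by (intro powr_mono2') auto
            then have "\<bar>h x\<bar> / x * \<sigma> x powr (1 - q) \<le> \<sigma> t powr (1 - q) * (\<bar>h x\<bar> / x)"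
              using elim by (subst mult.commute) (intro mult_right_mono, auto)
            then show ?thesis
              using True elim by (simp add: ennreal_mult[symmetric] ennreal_leI)
          qed simp
        qed
      qed
      also have "\<dots> = ennreal (\<sigma> t powr (1 - q)) * H t"
        unfolding H_def by (intro nn_integral_cmult) measurable
      also have "\<dots> = ennreal (\<sigma> t powr (1 - q) * y)"
        using y by (simp add: ennreal_mult)
      also have "\<dots> \<le> ennreal ((1 / c) powr q * W t)"
      proof (rule ennreal_leI, cases "y = 0")
        case True
        then show "\<sigma> t powr (1 - q) * y \<le> (1 / c) powr q * W t"
          using W_pos[OF t] by simp
      next
        case False
        with y have y: "0 < y" "H t = ennreal y" by auto
        have "ennreal (y powr (p - 1) * V t) \<le> ennreal (\<sigma> t)"
          using head_lower[OF t, of "p - 1"] p y S_eq[OF t]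
          by (simp add: S_def ennpowr_ennreal ennreal_mult less_imp_le[OF V_pos[OF t]])
        then have "y powr (p - 1) * V t \<le> \<sigma> t"
          using \<sigma>_pos[OF t] by (simp add: ennreal_le_iff)
        then have "\<sigma> t powr (1 - q) \<le> (y powr (p - 1) * V t) powr (1 - q)"
          using e y V_pos[OF t] by (intro powr_mono2') auto
        also have "\<dots> = V t powr (1 - q) / y"
        proof -
          have "(p - 1) * (1 - q) = -1" using e by (simp add: algebra_simps)
          then show ?thesis
            using y V_pos[OF t] by (simp add: powr_mult powr_powr powr_minus divide_inverse)
        qed
        finally have 1: "\<sigma> t powr (1 - q) * y \<le> V t powr (1 - q)"
          using y by (simp add: pos_le_divide_eq)
        have "c powr q \<le> (V t powr (1 / p) * W t powr (1 / q)) powr q"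
          using c t e by (intro powr_mono2) auto
        also have "\<dots> = V t powr (q - 1) * W t"
          using e(1,4) V_pos[OF t] W_pos[OF t] by (simp add: powr_mult powr_powr)
        finally have "V t powr (1 - q) * c powr q \<le> V t powr (1 - q) * (V t powr (q - 1) * W t)"
          by (intro mult_left_mono) auto
        also have "\<dots> = W t"
          using V_pos[OF t] by (simp add: mult.assoc[symmetric] powr_add[symmetric])
        finally have "V t powr (1 - q) \<le> (1 / c) powr q * W t"
          using c by (simp add: powr_divide field_simps)
        with 1 show "\<sigma> t powr (1 - q) * y \<le> (1 / c) powr q * W t" by simp
      qed
      finally show "(\<integral>\<^sup>+x\<in>{t<..}. ennreal (\<bar>g x\<bar> powr q * w x) \<partial>half_lebesgue)
          \<le> ennreal ((1 / c) powr q * W t)" .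
    qed (use c in auto)
    ultimately show ?thesis
      using that[of f g] by simp
  qed
qed


section \<open>The best constants\<close>

text \<open>The least admissible constant is the supremum of the products over \<open>t\<close>; the supremum is positive,
  hence itself admissible.\<close>

lemma Mstar_const_bound:
  assumes "0 < C" "\<forall>t>0. Mstar_product p v t \<le> ennreal C" and "0 < t"
  shows "V t powr (1 / p) * W t powr (1 / q) \<le> Mstar_const p v"
proof -
  define P where "P t = V t powr (1 / p) * W t powr (1 / q)" for t
  have P_pos: "0 < P t" if "0 < t" for t
    using V_pos[OF that] W_pos[OF that] by (simp add: P_def)
  have iff: "(\<forall>t>0. Mstar_product p v t \<le> ennreal D) \<longleftrightarrow> (\<forall>t\<in>{0<..}. P t \<le> D)" if "0 < D" for D
    using that by (auto simp: Mstar_product_eq P_def)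
  have bdd: "bdd_above (P ` {0<..})"
    using assms iff by (intro bdd_aboveI2[of _ _ C]) auto
  have "Mstar_const p v = (SUP t\<in>{0<..}. P t)"
    unfolding Mstar_const_def
  proof (rule Least_equality)
    have "P t \<le> (SUP t\<in>{0<..}. P t)" if "0 < t" for t
      using that bdd by (intro cSUP_upper) auto
    moreover from this[of 1] have "0 < (SUP t\<in>{0<..}. P t)"
      using P_pos[of 1] by simp
    ultimately show "0 < (SUP t\<in>{0<..}. P t) \<and>
        (\<forall>t>0. Mstar_product p v t \<le> ennreal (SUP t\<in>{0<..}. P t))"
      by (simp add: iff)
    show "(SUP t\<in>{0<..}. P t) \<le> D" if "0 < D \<and> (\<forall>t>0. Mstar_product p v t \<le> ennreal D)" for D
      using that iff by (intro cSUP_least) auto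
  qed
  also have "P t \<le> \<dots>"
    using assms bdd by (intro cSUP_upper) auto
  finally show ?thesis by (simp add: P_def)
qed

text \<open>The greatest admissible constant is the infimum of the products over \<open>t\<close>. It is positive because
  it is at least the given \<open>C\<close>.\<close>

lemma mstar_const_bound:
  assumes "0 < C" "\<forall>t>0. Mstar_product p v t \<ge> ennreal C"
  shows "0 < mstar_const p v"
    and "0 < t \<Longrightarrow> mstar_const p v \<le> V t powr (1 / p) * W t powr (1 / q)"
proof -
  define P where "P t = V t powr (1 / p) * W t powr (1 / q)" for t
  have iff: "(\<forall>t>0. Mstar_product p v t \<ge> ennreal D) \<longleftrightarrow> (\<forall>t\<in>{0<..}. D \<le> P t)" for D
    by (auto simp: Mstar_product_eq P_def)
  have bdd: "bdd_below (P ` {0<..})"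
    using assms iff by (intro bdd_belowI2[of _ C]) auto
  have C: "C \<le> (INF t\<in>{0<..}. P t)"
    using assms iff by (intro cINF_greatest) auto
  have eq: "mstar_const p v = (INF t\<in>{0<..}. P t)"
    unfolding mstar_const_def
  proof (rule Greatest_equality)
    have "(INF t\<in>{0<..}. P t) \<le> P t" if "0 < t" for t
      using that bdd by (intro cINF_lower) auto
    then show "0 < (INF t\<in>{0<..}. P t) \<and>
        (\<forall>t>0. Mstar_product p v t \<ge> ennreal (INF t\<in>{0<..}. P t))"
      using C assms by (simp add: iff)
    show "D \<le> (INF t\<in>{0<..}. P t)" if "0 < D \<and> (\<forall>t>0. Mstar_product p v t \<ge> ennreal D)" for D
      using that iff by (intro cINF_greatest) auto
  qed
  show "0 < mstar_const p v" using C assms eq by simp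
  show "mstar_const p v \<le> V t powr (1 / p) * W t powr (1 / q)" if "0 < t"
    unfolding eq P_def[symmetric] using that bdd by (intro cINF_lower) auto
qed

end

section \<open>Factorization of the weighted Copson space\<close>

theorem theorem4p1:
  fixes p p' :: real and v :: "real \<Rightarrow> real"
  assumes "p > 1" and "p' = p / (p - 1)"
    and "weight v" and "v \<in> Mstar p" and "v \<in> mstar p"
  shows "(\<forall>h :: real \<Rightarrow> real. half_measurable h \<longrightarrow>
      (h \<in> Cop p v \<longleftrightarrow>
        (\<exists>f \<in> Lp p v. \<exists>g \<in> Gstar p' (\<lambda>x. v x powr (1 - p')).
           AE x in lebesgue_on {0<..}. h x = f x * g x))) \<and>
    (\<forall>h \<in> Cop p v.
      ennreal (mstar_const p v) * Nstar p v h \<le> Cop_norm p v h \<and>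
      Cop_norm p v h \<le> ennreal (p' powr (1 / p') * p powr (1 / p) * Mstar_const p v) * Nstar p v h)"
proof -
  obtain C where C: "0 < C" "\<forall>t>0. Mstar_product p v t \<le> ennreal C"
    using assms(4) by (auto simp: Mstar_def)
  obtain c where c: "0 < c" "\<forall>t>0. Mstar_product p v t \<ge> ennreal c"
    using assms(5) by (auto simp: mstar_def)
  interpret copson_weight p p' v
  proof
    show "Mstar_product p v t < top" if "0 < t" for t
      using C that by (auto intro: le_less_trans)
  qed (use assms in \<open>auto simp: weight_def half_measurable_def\<close>)
  note m = mstar_const_bound[OF c]
  let ?u = "\<lambda>x. v x powr (1 - p')"
  let ?K = "p' powr (1 / p') * p powr (1 / p) * Mstar_const p v"
  have conj: "conj_exp p = p'" using assms by (simp add: conj_exp_def)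
  have dual: "dual_weight p v = ?u" by (simp add: dual_weight_def conj)
  have K: "0 < ?K"
  proof -
    have "mstar_const p v \<le> Mstar_const p v"
      using m(2)[of 1] Mstar_const_bound[OF C, of 1] by simp
    then show ?thesis using m(1) exponents(1) assms(1) by simp
  qed
  have inverse_K: "?K * (1 / ?K) = 1"
    using less_imp_neq[OF K, symmetric] by (metis divide_self mult.right_neutral times_divide_eq_right)
  have upper: "Cop_norm p v h \<le> ennreal ?K * (Lp_norm p v f * Gstar_norm p' ?u g)"
    if "f \<in> Lp p v" "g \<in> Gstar p' ?u" "AE x in half_lebesgue. h x = f x * g x" for f g h
  proof -
    obtain G where G: "0 \<le> G" "Gstar_norm p' ?u g = ennreal G"
      using \<open>g \<in> Gstar p' ?u\<close> by (cases "Gstar_norm p' ?u g") (auto simp: Gstar_def)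
    have "Cop_norm p v h \<le> ennreal (?K * G) * Lp_norm p v f"
      using that G by (intro Cop_norm_le_of_factorization Mstar_const_bound[OF C])
        (auto simp: Lp_def Gstar_def half_measurable_def)
    then show ?thesis
      using K G by (simp add: ennreal_mult mult_ac)
  qed
  have lower: "\<exists>f \<in> Lp p v. \<exists>g \<in> Gstar p' ?u. (AE x in half_lebesgue. h x = f x * g x) \<and>
      Lp_norm p v f \<le> Cop_norm p v h \<and> Gstar_norm p' ?u g \<le> ennreal (1 / mstar_const p v)"
    if h: "h \<in> Cop p v" for h
  proof -
    have "h \<in> borel_measurable half_lebesgue" "Cop_norm p v h < top"
      using h by (auto simp: Cop_def half_measurable_def)
    from factorization_of_Cop[OF this m] obtain f g where
      "f \<in> borel_measurable half_lebesgue" "g \<in> borel_measurable half_lebesgue"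
      "AE x in half_lebesgue. h x = f x * g x" "Lp_norm p v f \<le> Cop_norm p v h"
      "Gstar_norm p' ?u g \<le> ennreal (1 / mstar_const p v)"
      by blast
    with \<open>Cop_norm p v h < top\<close> show ?thesis
      by (intro bexI[of _ f] bexI[of _ g])
         (auto simp: Lp_def Gstar_def half_measurable_def intro: le_less_trans)
  qed
  have "h \<in> Cop p v \<longleftrightarrow>
      (\<exists>f \<in> Lp p v. \<exists>g \<in> Gstar p' ?u. AE x in half_lebesgue. h x = f x * g x)"
    if "half_measurable h" for h
  proof
    assume "\<exists>f \<in> Lp p v. \<exists>g \<in> Gstar p' ?u. AE x in half_lebesgue. h x = f x * g x"
    then obtain f g where fg: "f \<in> Lp p v" "g \<in> Gstar p' ?u"
      "AE x in half_lebesgue. h x = f x * g x" by blast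
    have "ennreal ?K * (Lp_norm p v f * Gstar_norm p' ?u g) < top"
      using fg by (auto simp: Lp_def Gstar_def ennreal_mult_less_top)
    with upper[OF fg] show "h \<in> Cop p v"
      using that by (auto simp: Cop_def)
  qed (use lower in blast)
  moreover have "ennreal (mstar_const p v) * Nstar p v h \<le> Cop_norm p v h" if "h \<in> Cop p v" for h
  proof -
    obtain f g where fg: "f \<in> Lp p v" "g \<in> Gstar p' ?u" "AE x in half_lebesgue. h x = f x * g x"
      "Lp_norm p v f \<le> Cop_norm p v h" "Gstar_norm p' ?u g \<le> ennreal (1 / mstar_const p v)"
      using lower[OF \<open>h \<in> Cop p v\<close>] by blast
    have "Nstar p v h \<le> Lp_norm p v f * Gstar_norm p' ?u g"
      unfolding Nstar_def conj dual using fg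
      by (intro INF_lower2[of "(f, g)"]) (auto simp: factorizations_def conj dual)
    also have "\<dots> \<le> Cop_norm p v h * ennreal (1 / mstar_const p v)"
      using fg by (intro mult_mono) auto
    finally have "ennreal (mstar_const p v) * Nstar p v h
        \<le> ennreal (mstar_const p v) * (Cop_norm p v h * ennreal (1 / mstar_const p v))"
      by (intro mult_left_mono) auto
    also have "\<dots> = Cop_norm p v h * (ennreal (mstar_const p v) * ennreal (1 / mstar_const p v))"
      by (simp add: mult_ac)
    also have "\<dots> = Cop_norm p v h"
      using m(1) by (simp add: ennreal_mult[symmetric])
    finally show ?thesis .
  qed
  moreover have "Cop_norm p v h \<le> ennreal ?K * Nstar p v h" for h
  proof -
    \<comment> \<open>Dividing by the constant first turns the claim into a lower bound for an infimum.\<close>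
    have "ennreal (1 / ?K) * Cop_norm p v h \<le> Nstar p v h"
      unfolding Nstar_def
    proof (rule INF_greatest, clarify)
      fix f g assume "(f, g) \<in> factorizations p v h"
      then have "Cop_norm p v h \<le> ennreal ?K * (Lp_norm p v f * Gstar_norm p' ?u g)"
        by (intro upper) (auto simp: factorizations_def conj dual)
      then have "ennreal (1 / ?K) * Cop_norm p v h
          \<le> ennreal (1 / ?K) * (ennreal ?K * (Lp_norm p v f * Gstar_norm p' ?u g))"
        by (intro mult_left_mono) auto
      also have "\<dots> = ennreal (1 / ?K * ?K) * (Lp_norm p v f * Gstar_norm p' ?u g)"
        using K by (subst ennreal_mult) (auto simp: mult.assoc)
      also have "1 / ?K * ?K = 1" by (subst mult.commute) (rule inverse_K)
      finally show "ennreal (1 / ?K) * Cop_norm p v h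
          \<le> Lp_norm p v f * Gstar_norm (conj_exp p) (dual_weight p v) g"
        by (simp add: conj dual)
    qed
    then have "ennreal ?K * (ennreal (1 / ?K) * Cop_norm p v h) \<le> ennreal ?K * Nstar p v h"
      by (intro mult_left_mono) auto
    moreover have "ennreal ?K * (ennreal (1 / ?K) * Cop_norm p v h)
        = ennreal (?K * (1 / ?K)) * Cop_norm p v h"
      using K by (subst ennreal_mult) (auto simp: mult.assoc)
    ultimately show ?thesis unfolding inverse_K by simp
  qed
  ultimately show ?thesis by simp
qed

end
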